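(* Let $d\ge 1$. For all $\mu,\nu,\tilde\nu\in\mathcal P_2(\mathbb R^d)$, $$\overline{\mathcal W}_2^2\big(\mathcal I_2(\mu,\nu),\mathcal I_2(\mu,\tilde\nu)\big)\le\Big(\overline{\mathcal W}_2(\mu,\mathcal I_2(\mu,\nu))+\overline{\mathcal W}_2(\mu,\mathcal I_2(\mu,\tilde\nu))\Big)\,\overline{\mathcal W}_2(\nu,\tilde\nu).$$
   Context: $\mathcal P_2(\mathbb R^d)$ is the set of probability measures on $\mathbb R^d$ with finite second moment and $\mathcal W_2$ is the quadratic Wasserstein distance, $\mathcal W_2^2(\mu,\nu)=\inf_{\pi}\int|x-y|^2\pi(dx,dy)$ over couplings $\pi$ of $\mu$ and $\nu$. For $\eta\in\mathcal P_2(\mathbb R^d)$, $m(\eta)=\int x\,\eta(dx)$. The centered Wasserstein distance is $\overline{\mathcal W}_2(\mu,\nu)=\left(\mathcal W_2^2(\mu,\nu)-|m(\mu)-m(\nu)|^2\right)^{1/2}$. The convex order is defined by $\mu\le_{cx}\nu$ iff $\int f\,d\mu\le\int f\,d\nu$ for every convex $f:\mathbb R^d\to\mathbb R$. $\mathcal I_2(\mu,\nu)$ denotes the (existing and unique) minimizer of $\eta\mapsto\mathcal W_2(\mu,\eta)$ over $\{\eta\in\mathcal P_2(\mathbb R^d):\eta\le_{cx}\nu\}$. *)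

theory Defs
  imports "HOL-Probability.Probability"
begin

definition P2 :: "'a::euclidean_space measure set" where
  "P2 = {\<mu>. prob_space \<mu> \<and> sets \<mu> = sets borel \<and> integrable \<mu> (\<lambda>x. (norm x)\<^sup>2)}"

definition couplings ::
  "'a::euclidean_space measure \<Rightarrow> 'a measure \<Rightarrow> ('a \<times> 'a) measure set" where
  "couplings \<mu> \<nu> =
     {\<pi>. sets \<pi> = sets (borel \<Otimes>\<^sub>M borel) \<and> distr \<pi> borel fst = \<mu> \<and> distr \<pi> borel snd = \<nu>}"

(* Only meaningful on P2: there every coupling has finite cost, so the Bochner integral never
   takes its default value 0, and the infimum is over a nonempty set of nonnegative reals. *)
definition W2 :: "'a::euclidean_space measure \<Rightarrow> 'a measure \<Rightarrow> real" where
  "W2 \<mu> \<nu> = sqrt (INF \<pi>\<in>couplings \<mu> \<nu>. \<integral>z. (norm (fst z - snd z))\<^sup>2 \<partial>\<pi>)"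

definition mean :: "'a::euclidean_space measure \<Rightarrow> 'a" where
  "mean \<eta> = (\<integral>x. x \<partial>\<eta>)"

definition centered_W2 :: "'a::euclidean_space measure \<Rightarrow> 'a measure \<Rightarrow> real" where
  "centered_W2 \<mu> \<nu> = sqrt ((W2 \<mu> \<nu>)\<^sup>2 - (norm (mean \<mu> - mean \<nu>))\<^sup>2)"

(* A convex function need not be integrable against a measure in P2, but it has an affine
   minorant, so its negative part is: the integral always exists in (-\<infinity>, \<infinity>]. *)
definition ext_integral :: "'a measure \<Rightarrow> ('a \<Rightarrow> real) \<Rightarrow> ereal" where
  "ext_integral \<mu> f =
     enn2ereal (\<integral>\<^sup>+x. ennreal (f x) \<partial>\<mu>) - enn2ereal (\<integral>\<^sup>+x. ennreal (- f x) \<partial>\<mu>)"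

definition convex_order ::
  "'a::euclidean_space measure \<Rightarrow> 'a measure \<Rightarrow> bool"  (infix "\<le>\<^sub>c\<^sub>x" 50) where
  "\<mu> \<le>\<^sub>c\<^sub>x \<nu> \<longleftrightarrow>
     (\<forall>f :: 'a \<Rightarrow> real. convex_on UNIV f \<longrightarrow> ext_integral \<mu> f \<le> ext_integral \<nu> f)"

(* For \<mu> and \<nu> in P2 the minimizer exists and is unique. *)
definition I2 :: "'a::euclidean_space measure \<Rightarrow> 'a measure \<Rightarrow> 'a measure" where
  "I2 \<mu> \<nu> = (THE \<eta>. is_arg_min (W2 \<mu>) (\<lambda>\<eta>. \<eta> \<in> P2 \<and> \<eta> \<le>\<^sub>c\<^sub>x \<nu>) \<eta>)"

end

theory Submission
  imports Defs
begin

text \<open>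
  In \<open>L\<^sup>2(\<mu>)\<close> the maps whose law is dominated by \<open>\<nu>\<close> in the convex order form a closed convex set
  \<open>C(\<nu>)\<close>. Averaging a coupling over its first marginal shows that \<open>I2 \<mu> \<nu>\<close> is the law of the
  projection \<open>T\<close> of the identity onto \<open>C(\<nu>)\<close>, and uniqueness follows from the parallelogram identity.
  If \<open>T'\<close> is the projection onto \<open>C(\<nu>')\<close> and \<open>(Y', Y)\<close> is a nearly optimal coupling of \<open>\<nu>'\<close> and
  \<open>\<nu>\<close>, a discrete version of Strassen's theorem makes \<open>T'\<close> nearly an average of \<open>Y'\<close>; the same
  average of \<open>Y\<close> is an element \<open>S\<close> of \<open>C(\<nu>)\<close>, and after centering \<open>S\<close> and \<open>T'\<close> are hardly further
  apart than the centered Wasserstein distance of \<open>\<nu>\<close> and \<open>\<nu>'\<close>. The claim is the sum of the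
  variational inequality \<open>\<langle>id - T, S - T\<rangle> \<le> 0\<close> and its counterpart with \<open>\<nu>\<close> and \<open>\<nu>'\<close> exchanged.
\<close>

section \<open>Square-integrable random vectors\<close>

text \<open>Two obstacles shape the proof. Optimal couplings and disintegrations are never formed:
  couplings are only nearly optimal, a coupling becomes a map only by averaging over the finitely
  many fibres of a simple function, and each estimate ends by sending its error to 0. A general
  convex function may have infinite integral, so membership in \<open>C(\<nu>)\<close> is tested on
  finite maxima of affine functions; these are Lipschitz, which makes \<open>C(\<nu>)\<close>
  closed, and have a subgradient everywhere, which gives Jensen's inequality for finite averages.
  Centering costs nothing because every map in \<open>C(\<nu>)\<close> has the mean of
  \<open>\<nu>\<close>. Hence \<open>S - T\<close> has mean zero and \<open>id - T\<close> may be
  centered in the variational inequality, while \<open>T' - S\<close> has mean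
  \<open>m(\<nu>') - m(\<nu>)\<close>, so its centering removes exactly the term subtracted in
  \<open>centered_W2\<close>. With \<open>A\<close>, \<open>A'\<close> the centered
  \<open>id - T\<close>, \<open>id - T'\<close> and \<open>D = A - A'\<close>, the identity
  \<open>|D|^2 = <A, D> + <A', -D>\<close> splits the claim into two halves, bounded by
  \<open>|A|\<close> and \<open>|A'|\<close> times the centered distance of \<open>\<nu>\<close> and
  \<open>\<nu>'\<close>.\<close>

definition square_integrable :: "'b measure \<Rightarrow> ('b \<Rightarrow> 'a::euclidean_space) \<Rightarrow> bool" where
  "square_integrable M Z \<longleftrightarrow> Z \<in> borel_measurable M \<and> integrable M (\<lambda>x. (norm (Z x))\<^sup>2)"

definition l2norm :: "'b measure \<Rightarrow> ('b \<Rightarrow> 'a::euclidean_space) \<Rightarrow> real" where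
  "l2norm M Z = sqrt (\<integral>x. (norm (Z x))\<^sup>2 \<partial>M)"

lemma l2norm_nonneg [simp]: "0 \<le> l2norm M Z"
  by (simp add: l2norm_def)

lemma l2norm_power2: "(l2norm M Z)\<^sup>2 = (\<integral>x. (norm (Z x))\<^sup>2 \<partial>M)"
  by (simp add: l2norm_def)

lemma square_integrable_measurable: "square_integrable M Z \<Longrightarrow> Z \<in> borel_measurable M"
  by (simp add: square_integrable_def)

lemma square_integrableD: "square_integrable M Z \<Longrightarrow> integrable M (\<lambda>x. (norm (Z x))\<^sup>2)"
  by (simp add: square_integrable_def)

lemma abs_inner_le_squares:
  fixes u v :: "'a::real_inner"
  shows "\<bar>u \<bullet> v\<bar> \<le> (norm u)\<^sup>2 + (norm v)\<^sup>2"
proof -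
  have "\<bar>u \<bullet> v\<bar> \<le> norm u * norm v"
    by (rule Cauchy_Schwarz_ineq2)
  also have "\<dots> \<le> (norm u)\<^sup>2 + (norm v)\<^sup>2"
    using sum_squares_bound[of "norm u" "norm v"] mult_nonneg_nonneg[OF norm_ge_zero norm_ge_zero, of u v]
    by linarith
  finally show ?thesis .
qed

lemma square_integrable_inner:
  assumes "square_integrable M Z" "square_integrable M W"
  shows "integrable M (\<lambda>x. Z x \<bullet> W x)"
proof (rule Bochner_Integration.integrable_bound)
  show "integrable M (\<lambda>x. (norm (Z x))\<^sup>2 + (norm (W x))\<^sup>2)"
    using assms by (auto dest: square_integrableD)
  show "(\<lambda>x. Z x \<bullet> W x) \<in> borel_measurable M"
    using assms by (auto simp: square_integrable_def)
  show "AE x in M. norm (Z x \<bullet> W x) \<le> norm ((norm (Z x))\<^sup>2 + (norm (W x))\<^sup>2)"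
    using abs_inner_le_squares by (fastforce intro!: AE_I2 simp: abs_of_nonneg)
qed

lemma norm_diff_power2:
  fixes u v :: "'a::real_inner"
  shows "(norm (u - v))\<^sup>2 = (norm u)\<^sup>2 - 2 * (u \<bullet> v) + (norm v)\<^sup>2"
  by (simp add: power2_norm_eq_inner inner_diff inner_commute)

lemma square_integrable_scaleR:
  assumes "square_integrable M Z"
  shows "square_integrable M (\<lambda>x. a *\<^sub>R Z x)"
  using assms by (auto simp: square_integrable_def power_mult_distrib)

lemma square_integrable_diff:
  assumes "square_integrable M Z" "square_integrable M W"
  shows "square_integrable M (\<lambda>x. Z x - W x)"
  using assms square_integrable_inner[OF assms]
  unfolding square_integrable_def norm_diff_power2 by auto

lemma square_integrable_add:
  assumes "square_integrable M Z" "square_integrable M W"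
  shows "square_integrable M (\<lambda>x. Z x + W x)"
  using square_integrable_diff[OF assms(1) square_integrable_scaleR[OF assms(2), of "-1"]] by simp

lemma l2norm_diff_power2:
  assumes "square_integrable M Z" "square_integrable M W"
  shows "(l2norm M (\<lambda>x. Z x - W x))\<^sup>2
    = (l2norm M Z)\<^sup>2 - 2 * (\<integral>x. Z x \<bullet> W x \<partial>M) + (l2norm M W)\<^sup>2"
  using assms square_integrable_inner[OF assms]
  unfolding l2norm_power2 norm_diff_power2 by (simp add: square_integrable_def)

lemma l2norm_scaleR: "l2norm M (\<lambda>x. a *\<^sub>R Z x) = \<bar>a\<bar> * l2norm M Z"
  by (simp add: l2norm_def power_mult_distrib real_sqrt_mult)

lemma l2norm_minus_commute: "l2norm M (\<lambda>x. Z x - W x) = l2norm M (\<lambda>x. W x - Z x)"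
  by (simp add: l2norm_def norm_minus_commute)

lemma l2norm_Cauchy_Schwarz:
  assumes "square_integrable M Z" "square_integrable M W"
  shows "(\<integral>x. Z x \<bullet> W x \<partial>M) \<le> l2norm M Z * l2norm M W"
proof -
  define A B I where "A = l2norm M Z" and "B = l2norm M W" and "I = (\<integral>x. Z x \<bullet> W x \<partial>M)"
  have *: "2 * a * b * I \<le> b\<^sup>2 * A\<^sup>2 + a\<^sup>2 * B\<^sup>2" for a b
  proof -
    have "0 \<le> (l2norm M (\<lambda>x. b *\<^sub>R Z x - a *\<^sub>R W x))\<^sup>2" by simp
    also have "\<dots> = b\<^sup>2 * A\<^sup>2 - 2 * (\<integral>x. (b *\<^sub>R Z x) \<bullet> (a *\<^sub>R W x) \<partial>M) + a\<^sup>2 * B\<^sup>2"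
      using assms by (subst l2norm_diff_power2)
        (auto intro: square_integrable_scaleR simp: l2norm_scaleR A_def B_def power_mult_distrib)
    also have "(\<integral>x. (b *\<^sub>R Z x) \<bullet> (a *\<^sub>R W x) \<partial>M) = b * a * I"
      by (simp add: I_def mult_ac)
    finally show ?thesis by (simp add: algebra_simps)
  qed
  have pos: "0 \<le> A" "0 \<le> B" by (auto simp: A_def B_def)
  \<comment> \<open>Adding \<open>e\<close> to both norms keeps the common factor positive, so it
    can be cancelled even if \<open>A\<close> or \<open>B\<close> vanishes.\<close>
  have "I \<le> (A + e) * (B + e)" if "0 < e" for e
  proof -
    have p: "0 < (A + e) * (B + e)" using that pos by (intro mult_pos_pos) auto
    have "2 * (A + e) * (B + e) * I \<le> (B + e)\<^sup>2 * A\<^sup>2 + (A + e)\<^sup>2 * B\<^sup>2" by (rule *)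
    also have "\<dots> \<le> (B + e)\<^sup>2 * (A + e)\<^sup>2 + (A + e)\<^sup>2 * (B + e)\<^sup>2"
      using that pos by (intro add_mono mult_left_mono power_mono) auto
    also have "\<dots> = 2 * (A + e) * (B + e) * ((A + e) * (B + e))"
      by (simp add: power2_eq_square)
    finally have "(2 * ((A + e) * (B + e))) * I \<le> (2 * ((A + e) * (B + e))) * ((A + e) * (B + e))"
      by (simp only: mult.assoc)
    then show ?thesis using p by (subst (asm) mult_le_cancel_left_pos) auto
  qed
  then have "eventually (\<lambda>e. I \<le> (A + e) * (B + e)) (at_right 0)"
    by (auto simp: eventually_at_filter)
  moreover have "((\<lambda>e. (A + e) * (B + e)) \<longlongrightarrow> (A + 0) * (B + 0)) (at_right 0)"
    by (intro tendsto_intros)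
  ultimately have "I \<le> (A + 0) * (B + 0)"
    by (intro tendsto_lowerbound) auto
  then show ?thesis by (simp add: A_def B_def I_def)
qed

lemma l2norm_diff_triangle:
  assumes "square_integrable M Z" "square_integrable M W"
  shows "l2norm M (\<lambda>x. Z x - W x) \<le> l2norm M Z + l2norm M W"
proof (rule power2_le_imp_le)
  have "- (\<integral>x. Z x \<bullet> W x \<partial>M) \<le> l2norm M Z * l2norm M W"
    using l2norm_Cauchy_Schwarz[OF square_integrable_scaleR[OF assms(1), of "-1"] assms(2)]
      l2norm_scaleR[of M "-1" Z] by simp
  then show "(l2norm M (\<lambda>x. Z x - W x))\<^sup>2 \<le> (l2norm M Z + l2norm M W)\<^sup>2"
    using l2norm_diff_power2[OF assms] power2_sum[of "l2norm M Z" "l2norm M W"] by linarith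
qed simp

lemma l2norm_triangle:
  assumes "square_integrable M X" "square_integrable M Y" "square_integrable M Z"
  shows "l2norm M (\<lambda>x. X x - Z x) \<le> l2norm M (\<lambda>x. X x - Y x) + l2norm M (\<lambda>x. Y x - Z x)"
  using l2norm_diff_triangle[OF square_integrable_diff[OF assms(1,2)] square_integrable_diff[OF assms(3,2)]]
  by (simp add: l2norm_minus_commute[of M Z Y])

lemma parallelogram:
  fixes u v :: "'a::real_inner"
  shows "(norm ((1/2) *\<^sub>R (u + v)))\<^sup>2 = (norm u)\<^sup>2 / 2 + (norm v)\<^sup>2 / 2 - (norm (u - v))\<^sup>2 / 4"
  by (simp add: power2_norm_eq_inner inner_diff inner_add inner_commute field_simps)

lemma l2norm_parallelogram:
  assumes "square_integrable M Z" "square_integrable M W"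
  shows "(l2norm M (\<lambda>x. (1/2) *\<^sub>R (Z x + W x)))\<^sup>2
    = (l2norm M Z)\<^sup>2 / 2 + (l2norm M W)\<^sup>2 / 2 - (l2norm M (\<lambda>x. Z x - W x))\<^sup>2 / 4"
  using square_integrableD[OF assms(1)] square_integrableD[OF assms(2)]
    square_integrableD[OF square_integrable_diff[OF assms]]
  unfolding l2norm_power2 parallelogram by simp

lemma (in finite_measure) square_integrable_const: "square_integrable M (\<lambda>_. c)"
  by (simp add: square_integrable_def)

lemma (in finite_measure) square_integrable_integrable:
  assumes "square_integrable M Z"
  shows "integrable M Z"
proof (rule Bochner_Integration.integrable_bound)
  show "integrable M (\<lambda>x. 1 + (norm (Z x))\<^sup>2)"
    using assms by (auto dest: square_integrableD)
  show "Z \<in> borel_measurable M" using assms by (rule square_integrable_measurable)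
  have "norm u \<le> 1 + (norm u)\<^sup>2" for u :: 'b
    using sum_squares_bound[of 1 "norm u"] norm_ge_zero[of u] by (simp del: norm_ge_zero)
  then show "AE x in M. norm (Z x) \<le> norm (1 + (norm (Z x))\<^sup>2)"
    by (intro AE_I2) (auto simp: abs_of_nonneg)
qed

text \<open>The variance identity; it is the counterpart for maps of the subtraction in
  \<open>centered_W2\<close>.\<close>

lemma (in prob_space) l2norm_centered:
  assumes "square_integrable M Z"
  shows "(l2norm M (\<lambda>x. Z x - expectation Z))\<^sup>2 = (l2norm M Z)\<^sup>2 - (norm (expectation Z))\<^sup>2"
proof -
  note sc = square_integrable_const[of "expectation Z"]
  have "expectation (\<lambda>x. Z x \<bullet> expectation Z) = (norm (expectation Z))\<^sup>2"
    using square_integrable_integrable[OF assms] by (simp add: power2_norm_eq_inner)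
  moreover have "(l2norm M (\<lambda>x. expectation Z))\<^sup>2 = (norm (expectation Z))\<^sup>2"
    by (simp add: l2norm_power2 prob_space)
  ultimately show ?thesis
    unfolding l2norm_diff_power2[OF assms sc] by simp
qed

lemma (in prob_space) norm_expectation_le_l2norm:
  assumes "square_integrable M Z"
  shows "norm (expectation Z) \<le> l2norm M Z"
proof (rule power2_le_imp_le)
  show "(norm (expectation Z))\<^sup>2 \<le> (l2norm M Z)\<^sup>2"
    using l2norm_centered[OF assms] zero_le_power2[of "l2norm M (\<lambda>x. Z x - expectation Z)"] by linarith
qed simp

lemma (in prob_space) expectation_norm_le_l2norm:
  assumes "square_integrable M Z"
  shows "expectation (\<lambda>x. norm (Z x)) \<le> l2norm M Z"
proof -
  have "square_integrable M (\<lambda>x. norm (Z x))"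
    using assms by (auto simp: square_integrable_def)
  from norm_expectation_le_l2norm[OF this] show ?thesis
    by (simp add: l2norm_def)
qed

lemma square_integrable_distr:
  assumes [measurable]: "X \<in> measurable M N" and [measurable]: "Z \<in> borel_measurable N"
  shows "square_integrable (distr M N X) Z \<longleftrightarrow> square_integrable M (\<lambda>x. Z (X x))"
  by (simp add: square_integrable_def integrable_distr_eq)

lemma l2norm_distr:
  assumes [measurable]: "X \<in> measurable M N" and [measurable]: "Z \<in> borel_measurable N"
  shows "l2norm (distr M N X) Z = l2norm M (\<lambda>x. Z (X x))"
  by (simp add: l2norm_def integral_distr)

text \<open>The finitely many fibres of \<open>R\<close> serve later as the cells over which
  couplings are averaged.\<close>

lemma square_integrable_simple_approx:
  fixes Z :: "'b \<Rightarrow> 'a::euclidean_space"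
  assumes Z: "square_integrable M Z" and e: "0 < e"
  obtains R where "simple_function M R" "square_integrable M R" "l2norm M (\<lambda>x. Z x - R x) < e"
proof -
  have [measurable]: "Z \<in> borel_measurable M" using Z by (rule square_integrable_measurable)
  obtain s where s: "\<And>i. simple_function M (s i)"
    and lim: "\<And>x. x \<in> space M \<Longrightarrow> (\<lambda>i. s i x) \<longlonglongrightarrow> Z x"
    and bd: "\<And>i x. x \<in> space M \<Longrightarrow> dist (s i x) 0 \<le> 2 * dist (Z x) 0"
    using borel_measurable_implies_sequence_metric[of Z M 0] by (metis \<open>Z \<in> borel_measurable M\<close>)
  have [measurable]: "s i \<in> borel_measurable M" for i
    using s by (rule borel_measurable_simple_function)
  have sq: "square_integrable M (s i)" for i
    unfolding square_integrable_def
  proof (intro conjI Bochner_Integration.integrable_bound[where g="\<lambda>x. (norm (s i x))\<^sup>2" and f="\<lambda>x. 4 * (norm (Z x))\<^sup>2"])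
    show "integrable M (\<lambda>x. 4 * (norm (Z x))\<^sup>2)" using Z by (auto dest: square_integrableD)
    show "AE x in M. norm ((norm (s i x))\<^sup>2) \<le> norm (4 * (norm (Z x))\<^sup>2)"
    proof (rule AE_I2)
      fix x assume "x \<in> space M"
      then have "norm (s i x) \<le> 2 * norm (Z x)" using bd[of x i] by simp
      from power_mono[OF this, of 2] show "norm ((norm (s i x))\<^sup>2) \<le> norm (4 * (norm (Z x))\<^sup>2)"
        by (simp add: power_mult_distrib)
    qed
  qed auto
  have "(\<lambda>i. \<integral>x. (norm (Z x - s i x))\<^sup>2 \<partial>M) \<longlonglongrightarrow> (\<integral>x. 0 \<partial>M)"
  \<comment> \<open>The approximants are at most twice as large as \<open>Z\<close>, so the
    difference is at most three times as large, whence the factor 9.\<close>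
  proof (rule integral_dominated_convergence[where w="\<lambda>x. 9 * (norm (Z x))\<^sup>2"])
    show "integrable M (\<lambda>x. 9 * (norm (Z x))\<^sup>2)" using Z by (auto dest: square_integrableD)
    show "AE x in M. (\<lambda>i. (norm (Z x - s i x))\<^sup>2) \<longlonglongrightarrow> 0"
    proof (rule AE_I2)
      fix x assume "x \<in> space M"
      then have "(\<lambda>i. (norm (Z x - s i x))\<^sup>2) \<longlonglongrightarrow> (norm (Z x - Z x))\<^sup>2"
        by (intro tendsto_intros lim)
      then show "(\<lambda>i. (norm (Z x - s i x))\<^sup>2) \<longlonglongrightarrow> 0" by simp
    qed
    show "AE x in M. norm ((norm (Z x - s i x))\<^sup>2) \<le> 9 * (norm (Z x))\<^sup>2" for i
    proof (rule AE_I2)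
      fix x assume "x \<in> space M"
      then have "norm (Z x - s i x) \<le> 3 * norm (Z x)"
        using bd[of x i] norm_triangle_ineq4[of "Z x" "s i x"] by simp
      from power_mono[OF this, of 2] show "norm ((norm (Z x - s i x))\<^sup>2) \<le> 9 * (norm (Z x))\<^sup>2"
        by (simp add: power_mult_distrib)
    qed
  qed auto
  then have "\<forall>\<^sub>F i in sequentially. (\<integral>x. (norm (Z x - s i x))\<^sup>2 \<partial>M) < e\<^sup>2"
    using e by (intro order_tendstoD(2)) auto
  then obtain i where "(\<integral>x. (norm (Z x - s i x))\<^sup>2 \<partial>M) < e\<^sup>2"
    by (auto simp: eventually_sequentially)
  then have "l2norm M (\<lambda>x. Z x - s i x) < e"
    using e by (simp add: l2norm_def real_less_lsqrt)
  with s sq show ?thesis by (intro that)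
qed

section \<open>Testing the convex order on finite maxima of affine functions\<close>

text \<open>A pair holds the constant term and the slope of an affine function. The value is
  meaningful only for finite nonempty \<open>F\<close>.\<close>

definition max_affine :: "(real \<times> 'a) set \<Rightarrow> 'a::euclidean_space \<Rightarrow> real" where
  "max_affine F y = Max ((\<lambda>(c, h). c + h \<bullet> y) ` F)"

text \<open>Membership of \<open>Z\<close> in \<open>C(\<nu>)\<close>, on an arbitrary space
  \<open>M\<close>, so that it applies to maps on \<open>\<mu>\<close> and to the coordinates of a
  coupling alike. On the restricted test class all integrals that occur are finite reals.\<close>

definition dominated :: "'b measure \<Rightarrow> ('b \<Rightarrow> 'a::euclidean_space) \<Rightarrow> 'a measure \<Rightarrow> bool" where
  "dominated M Z \<nu> \<longleftrightarrow> square_integrable M Z \<and>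
     (\<forall>F. finite F \<longrightarrow> F \<noteq> {} \<longrightarrow> (\<integral>x. max_affine F (Z x) \<partial>M) \<le> (\<integral>y. max_affine F y \<partial>\<nu>))"

lemma dominatedD: "dominated M Z \<nu> \<Longrightarrow> finite F \<Longrightarrow> F \<noteq> {} \<Longrightarrow>
    (\<integral>x. max_affine F (Z x) \<partial>M) \<le> (\<integral>y. max_affine F y \<partial>\<nu>)"
  by (simp add: dominated_def)

lemma dominated_square_integrable: "dominated M Z \<nu> \<Longrightarrow> square_integrable M Z"
  by (simp add: dominated_def)

lemma max_affine_ge: "finite F \<Longrightarrow> (c, h) \<in> F \<Longrightarrow> c + h \<bullet> y \<le> max_affine F y"
  unfolding max_affine_def by (intro Max_ge) force+

lemma max_affine_attained:
  assumes "finite F" "F \<noteq> {}"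
  obtains c h where "(c, h) \<in> F" "max_affine F y = c + h \<bullet> y"
proof -
  have "max_affine F y \<in> (\<lambda>(c, h). c + h \<bullet> y) ` F"
    unfolding max_affine_def using assms by (intro Max_in) auto
  then show ?thesis using that by auto
qed

lemma max_affine_le:
  assumes "finite F" "F \<noteq> {}" "\<And>c h. (c, h) \<in> F \<Longrightarrow> c + h \<bullet> y \<le> t"
  shows "max_affine F y \<le> t"
  using assms by (metis max_affine_attained)

lemma max_affine_singleton [simp]: "max_affine {(c, h)} y = c + h \<bullet> y"
  by (simp add: max_affine_def)

lemma max_affine_lipschitz:
  assumes "finite F" "F \<noteq> {}"
  shows "\<bar>max_affine F x - max_affine F y\<bar> \<le> (\<Sum>(c, h)\<in>F. norm h) * norm (x - y)"
proof -
  have *: "max_affine F x \<le> max_affine F y + (\<Sum>(c, h)\<in>F. norm h) * norm (x - y)" for x y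
  proof (rule max_affine_le[OF assms])
    fix c h assume ch: "(c, h) \<in> F"
    have "norm h \<le> (\<Sum>(c, h)\<in>F. norm h)"
      using member_le_sum[OF ch, of "\<lambda>(c, h). norm h"] assms by auto
    moreover have "h \<bullet> x - h \<bullet> y \<le> norm h * norm (x - y)"
      unfolding inner_diff_right[symmetric] by (rule norm_cauchy_schwarz)
    ultimately have "h \<bullet> x - h \<bullet> y \<le> (\<Sum>(c, h)\<in>F. norm h) * norm (x - y)"
      by (meson mult_right_mono norm_ge_zero order_trans)
    with max_affine_ge[OF assms(1) ch, of y]
    show "c + h \<bullet> x \<le> max_affine F y + (\<Sum>(c, h)\<in>F. norm h) * norm (x - y)"
      by linarith
  qed
  from *[of x y] *[of y x] show ?thesis
    by (simp add: abs_le_iff norm_minus_commute)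
qed

lemma max_affine_convex:
  assumes "finite F" "F \<noteq> {}" "0 \<le> a" "0 \<le> b" "a + b = 1"
  shows "max_affine F (a *\<^sub>R x + b *\<^sub>R y) \<le> a * max_affine F x + b * max_affine F y"
proof (rule max_affine_le[OF assms(1,2)])
  fix c h assume "(c, h) \<in> F"
  then have "a * (c + h \<bullet> x) + b * (c + h \<bullet> y) \<le> a * max_affine F x + b * max_affine F y"
    using assms by (intro add_mono mult_left_mono max_affine_ge)
  moreover have "a * (c + h \<bullet> x) + b * (c + h \<bullet> y) = (a + b) * c + h \<bullet> (a *\<^sub>R x + b *\<^sub>R y)"
    by (simp add: inner_add_right algebra_simps)
  ultimately show "c + h \<bullet> (a *\<^sub>R x + b *\<^sub>R y) \<le> a * max_affine F x + b * max_affine F y"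
    using assms by simp
qed

lemma max_affine_continuous:
  assumes "finite F" "F \<noteq> {}"
  shows "continuous_on UNIV (max_affine F)"
proof (rule lipschitz_on_continuous_on)
  show "(\<Sum>(c, h)\<in>F. norm h)-lipschitz_on UNIV (max_affine F)"
    using max_affine_lipschitz[OF assms]
    by (intro lipschitz_onI) (auto simp: dist_norm intro!: sum_nonneg)
qed

lemma max_affine_measurable:
  "finite F \<Longrightarrow> F \<noteq> {} \<Longrightarrow> max_affine F \<in> borel_measurable borel"
  by (intro borel_measurable_continuous_onI max_affine_continuous)

lemma (in finite_measure) max_affine_integrable:
  assumes "square_integrable M Z" "finite F" "F \<noteq> {}"
  shows "integrable M (\<lambda>x. max_affine F (Z x))"
proof (rule Bochner_Integration.integrable_bound)
  have Z: "integrable M Z" using assms by (intro square_integrable_integrable)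
  let ?L = "\<Sum>(c, h)\<in>F. norm h"
  show "integrable M (\<lambda>x. \<bar>max_affine F 0\<bar> + ?L * norm (Z x))"
    using Z by auto
  show "(\<lambda>x. max_affine F (Z x)) \<in> borel_measurable M"
    using assms max_affine_measurable by (metis measurable_compose square_integrable_measurable)
  show "AE x in M. norm (max_affine F (Z x)) \<le> norm (\<bar>max_affine F 0\<bar> + ?L * norm (Z x))"
  proof (rule AE_I2)
    fix x
    have "\<bar>max_affine F (Z x) - max_affine F 0\<bar> \<le> ?L * norm (Z x - 0)"
      by (rule max_affine_lipschitz[OF assms(2,3)])
    then show "norm (max_affine F (Z x)) \<le> norm (\<bar>max_affine F 0\<bar> + ?L * norm (Z x))"
      by simp
  qed
qed

section \<open>Extended integrals and affine minorants of convex functions\<close>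

lemma ext_integral_eq:
  assumes [measurable]: "f \<in> borel_measurable M" and g: "integrable M g"
    and le: "\<And>x. x \<in> space M \<Longrightarrow> g x \<le> f x"
  shows "ext_integral M f = enn2ereal (\<integral>\<^sup>+x. ennreal (f x - g x) \<partial>M) + ereal (\<integral>x. g x \<partial>M)"
proof -
  have [measurable]: "g \<in> borel_measurable M" using g by auto
  define P N D Gp Gn where "P = (\<integral>\<^sup>+x. ennreal (f x) \<partial>M)" and "N = (\<integral>\<^sup>+x. ennreal (- f x) \<partial>M)"
    and "D = (\<integral>\<^sup>+x. ennreal (f x - g x) \<partial>M)"
    and "Gp = (\<integral>\<^sup>+x. ennreal (g x) \<partial>M)" and "Gn = (\<integral>\<^sup>+x. ennreal (- g x) \<partial>M)"
  have Gp: "Gp \<noteq> \<infinity>" and Gn: "Gn \<noteq> \<infinity>"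
    using g unfolding real_integrable_def Gp_def Gn_def by auto
  have "N \<le> Gn"
    unfolding N_def Gn_def using le by (intro nn_integral_mono ennreal_leI) auto
  then have N: "N \<noteq> \<infinity>" using Gn by (auto simp: top_unique)
  \<comment> \<open>Positive and negative parts are compared by an identity without subtraction.
    Since \<open>N\<close>, \<open>Gp\<close> and \<open>Gn\<close> are finite, it can be rearranged
    in the extended reals, also when \<open>P\<close> is infinite.\<close>
  have "P + Gn = (\<integral>\<^sup>+x. ennreal (f x) + ennreal (- g x) \<partial>M)"
    by (simp add: P_def Gn_def nn_integral_add)
  also have "\<dots> = (\<integral>\<^sup>+x. (ennreal (- f x) + ennreal (g x)) + ennreal (f x - g x) \<partial>M)"
  proof (rule nn_integral_cong)
    fix x assume "x \<in> space M"
    then have "g x \<le> f x" by (rule le)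
    then show "ennreal (f x) + ennreal (- g x) = ennreal (- f x) + ennreal (g x) + ennreal (f x - g x)"
      by (cases "0 \<le> f x"; cases "0 \<le> g x") (auto simp: ennreal_neg simp flip: ennreal_plus)
  qed
  also have "\<dots> = (N + Gp) + D"
    by (simp add: N_def Gp_def D_def nn_integral_add)
  finally have eq: "P + Gn = (N + Gp) + D" .
  obtain n gp gn where r: "N = ennreal n" "0 \<le> n" "Gp = ennreal gp" "0 \<le> gp" "Gn = ennreal gn" "0 \<le> gn"
    using N Gp Gn by (metis ennreal_cases infinity_ennreal_def)
  have int: "(\<integral>x. g x \<partial>M) = gp - gn"
    using r by (subst real_lebesgue_integral_def[OF g]) (simp add: Gp_def[symmetric] Gn_def[symmetric])
  have "enn2ereal P - enn2ereal N = enn2ereal D + ereal (gp - gn)"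
  proof (cases D)
    case top
    then have "P = \<infinity>" using eq r by (auto simp: top_unique)
    then show ?thesis using r top by simp
  next
    case (real d)
    then have "P \<noteq> \<infinity>" using eq r by (auto simp flip: ennreal_plus)
    then obtain p where p: "P = ennreal p" "0 \<le> p" by (metis ennreal_cases infinity_ennreal_def)
    have "ennreal (p + gn) = ennreal (n + gp + d)"
      using eq r p real by (simp flip: ennreal_plus)
    then have "p + gn = n + gp + d"
      using r p real by (subst (asm) ennreal_inj) auto
    then show ?thesis using r p real by (simp add: enn2ereal_ennreal)
  qed
  then show ?thesis by (simp add: ext_integral_def P_def N_def D_def int)
qed

lemma ext_integral_integrable:
  assumes "integrable M f"
  shows "ext_integral M f = ereal (\<integral>x. f x \<partial>M)"
  using ext_integral_eq[of f M f] assms by (simp add: zero_ennreal.rep_eq)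

text \<open>A hyperplane separating the point \<open>(x0, t0)\<close> from the closed epigraph of
  \<open>f\<close> is the graph of the required affine function, provided that it is not
  vertical.\<close>

lemma convex_affine_minorant:
  fixes f :: "'a::euclidean_space \<Rightarrow> real"
  assumes "convex_on UNIV f" "t0 < f x0"
  obtains c h where "\<And>y. c + h \<bullet> y \<le> f y" "t0 < c + h \<bullet> x0"
proof -
  have "continuous_on UNIV f" using assms by (intro convex_on_continuous) auto
  then have "closed (epigraph UNIV f)"
    unfolding epigraph_def
    by (auto intro!: closed_Collect_le continuous_intros elim: continuous_on_compose2)
  moreover have "convex (epigraph UNIV f)" using assms by (simp add: convex_epigraph)
  moreover have "(x0, t0) \<notin> epigraph UNIV f" using assms by (simp add: mem_epigraph)
  ultimately obtain a b where ab: "a \<bullet> (x0, t0) < b" "\<And>z. z \<in> epigraph UNIV f \<Longrightarrow> b < a \<bullet> z"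
    by (metis separating_hyperplane_closed_point)
  obtain p q where a: "a = (p, q)" by (cases a)
  have epi: "b < p \<bullet> y + q * f y" for y
    using ab(2)[of "(y, f y)"] by (simp add: mem_epigraph a)
  have at: "p \<bullet> x0 + q * t0 < b" using ab(1) by (simp add: a)
  \<comment> \<open>Comparing both sides of the separation over the same point \<open>x0\<close>
    excludes a vertical hyperplane and fixes its orientation.\<close>
  have "q * t0 < q * f x0" using at epi[of x0] by linarith
  then have "0 < q * (f x0 - t0)" by (simp add: algebra_simps)
  then have q: "0 < q" using assms by (simp add: zero_less_mult_iff)
  show ?thesis
  proof (rule that[of "b / q" "(- 1 / q) *\<^sub>R p"])
    show "b / q + ((- 1 / q) *\<^sub>R p) \<bullet> y \<le> f y" for y
      using epi[of y] q by (simp add: field_simps)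
    show "t0 < b / q + ((- 1 / q) *\<^sub>R p) \<bullet> x0"
      using at q by (simp add: field_simps)
  qed
qed

text \<open>The strict hypographs \<open>U a\<close> of all affine minorants are open and cover the
  strict hypograph of \<open>f\<close>; the Lindelof property leaves countably many of them.
  Countability is what monotone convergence requires.\<close>

lemma convex_countable_sup_affine:
  fixes f :: "'a::euclidean_space \<Rightarrow> real"
  assumes "convex_on UNIV f"
  obtains a :: "nat \<Rightarrow> real \<times> 'a"
  where "\<And>n y. fst (a n) + snd (a n) \<bullet> y \<le> f y"
    and "\<And>y t. t < f y \<Longrightarrow> \<exists>n. t < fst (a n) + snd (a n) \<bullet> y"
proof -
  define A where "A = {a. \<forall>y. fst a + snd a \<bullet> y \<le> f y}"
  define U where "U a = {z. snd z < fst a + snd a \<bullet> fst z}" for a :: "real \<times> 'a"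
  have "open (U a)" for a
    unfolding U_def by (intro open_Collect_less continuous_intros)
  then obtain \<F> where \<F>: "\<F> \<subseteq> U ` A" "countable \<F>" "\<Union>\<F> = \<Union>(U ` A)"
    by (metis (no_types, lifting) Lindelof imageE)
  then obtain A' where A': "countable A'" "A' \<subseteq> A" "\<F> = U ` A'"
    by (metis countable_subset_image)
  have cover: "\<exists>a\<in>A'. t < fst a + snd a \<bullet> y" if lt: "t < f y" for t y
  proof -
    obtain c h where "\<And>y. c + h \<bullet> y \<le> f y" "t < c + h \<bullet> y"
      using convex_affine_minorant[OF assms lt] by metis
    then have "(c, h) \<in> A" "(y, t) \<in> U (c, h)" by (auto simp: A_def U_def)
    then have "(y, t) \<in> \<Union>\<F>" using \<F>(3) by blast
    then show ?thesis using A'(3) by (auto simp: U_def)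
  qed
  have ne: "A' \<noteq> {}" using cover[of "f 0 - 1" 0] by auto
  show ?thesis
  proof (rule that[of "from_nat_into A'"])
    show "fst (from_nat_into A' n) + snd (from_nat_into A' n) \<bullet> y \<le> f y" for n y
      using from_nat_into[OF ne, of n] A'(2) by (auto simp: A_def)
    show "\<exists>n. t < fst (from_nat_into A' n) + snd (from_nat_into A' n) \<bullet> y" if "t < f y" for t y
      using cover[OF that] from_nat_into_surj[OF A'(1)] by metis
  qed
qed

lemma P2_square_integrable: "\<mu> \<in> P2 \<Longrightarrow> square_integrable \<mu> (\<lambda>x. x)"
  by (auto simp: P2_def square_integrable_def measurable_ident_sets)

lemma P2_prob_space: "\<mu> \<in> P2 \<Longrightarrow> prob_space \<mu>"
  by (simp add: P2_def)

lemma P2_sets: "\<mu> \<in> P2 \<Longrightarrow> sets \<mu> = sets borel"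
  by (simp add: P2_def)

lemma P2_max_affine_integrable:
  "\<mu> \<in> P2 \<Longrightarrow> finite F \<Longrightarrow> F \<noteq> {} \<Longrightarrow> integrable \<mu> (max_affine F)"
  using finite_measure.max_affine_integrable[of \<mu> "\<lambda>x. x" F]
  by (auto simp: P2_square_integrable P2_prob_space prob_space.finite_measure)

lemma max_affine_convex_on: "finite F \<Longrightarrow> F \<noteq> {} \<Longrightarrow> convex_on UNIV (max_affine F)"
  by (intro convex_onI) (auto intro: max_affine_convex)

text \<open>An affine function and its negative are both one-element maxima, so the inequality holds
  in both directions. This is why the convex order preserves means.\<close>

lemma max_affine_test_affine:
  assumes le: "\<And>F. finite F \<Longrightarrow> F \<noteq> {} \<Longrightarrow> (\<integral>x. max_affine F (Z x) \<partial>M) \<le> (\<integral>x. max_affine F (W x) \<partial>N)"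
  shows "(\<integral>x. c + h \<bullet> Z x \<partial>M) = (\<integral>x. c + h \<bullet> W x \<partial>N)"
proof (rule antisym)
  show "(\<integral>x. c + h \<bullet> Z x \<partial>M) \<le> (\<integral>x. c + h \<bullet> W x \<partial>N)"
    using le[of "{(c, h)}"] by simp
  have "(\<integral>x. - (c + h \<bullet> Z x) \<partial>M) \<le> (\<integral>x. - (c + h \<bullet> W x) \<partial>N)"
    using le[of "{(- c, - h)}"] by simp
  then show "(\<integral>x. c + h \<bullet> W x \<partial>N) \<le> (\<integral>x. c + h \<bullet> Z x \<partial>M)"
    unfolding integral_minus by simp
qed

text \<open>Every convex function is an increasing limit of finite maxima of affine minorants, so
  monotone convergence reduces the convex order to \<^const>\<open>max_affine\<close>.\<close>

lemma convex_order_iff_max_affine: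
  fixes \<eta> \<nu> :: "'a::euclidean_space measure"
  assumes \<eta>: "\<eta> \<in> P2" and \<nu>: "\<nu> \<in> P2"
  shows "\<eta> \<le>\<^sub>c\<^sub>x \<nu> \<longleftrightarrow>
    (\<forall>F. finite F \<longrightarrow> F \<noteq> {} \<longrightarrow> (\<integral>y. max_affine F y \<partial>\<eta>) \<le> (\<integral>y. max_affine F y \<partial>\<nu>))"
proof (intro iffI allI impI)
  fix F :: "(real \<times> 'a) set" assume "\<eta> \<le>\<^sub>c\<^sub>x \<nu>" and F: "finite F" "F \<noteq> {}"
  then have "ext_integral \<eta> (max_affine F) \<le> ext_integral \<nu> (max_affine F)"
    using max_affine_convex_on by (auto simp: convex_order_def)
  then show "(\<integral>y. max_affine F y \<partial>\<eta>) \<le> (\<integral>y. max_affine F y \<partial>\<nu>)"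
    using F P2_max_affine_integrable[OF \<eta>] P2_max_affine_integrable[OF \<nu>]
    by (simp add: ext_integral_integrable)
next
  assume "\<forall>F. finite F \<longrightarrow> F \<noteq> {} \<longrightarrow> (\<integral>y. max_affine F y \<partial>\<eta>) \<le> (\<integral>y. max_affine F y \<partial>\<nu>)"
  then have le: "(\<integral>y. max_affine F y \<partial>\<eta>) \<le> (\<integral>y. max_affine F y \<partial>\<nu>)" if "finite F" "F \<noteq> {}" for F
    using that by auto
  show "\<eta> \<le>\<^sub>c\<^sub>x \<nu>"
    unfolding convex_order_def
  proof (intro allI impI)
    fix f :: "'a \<Rightarrow> real" assume f: "convex_on UNIV f"
    obtain a :: "nat \<Rightarrow> real \<times> 'a" where a: "\<And>n y. fst (a n) + snd (a n) \<bullet> y \<le> f y"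
      and sup: "\<And>y t. t < f y \<Longrightarrow> \<exists>n. t < fst (a n) + snd (a n) \<bullet> y"
      using convex_countable_sup_affine[OF f] by metis
    define G where "G N = max_affine (a ` {..N})" for N
    \<comment> \<open>One affine minorant is subtracted from everything: the functions become
      nonnegative, and the subtracted integral is the same under \<open>\<eta>\<close> and
      \<open>\<nu>\<close>.\<close>
    define g where "g y = fst (a 0) + snd (a 0) \<bullet> y" for y
    have G_le: "G N y \<le> f y" for N y
      unfolding G_def using a by (intro max_affine_le) (auto, metis fst_conv snd_conv)
    have G_ge: "fst (a n) + snd (a n) \<bullet> y \<le> G N y" if "n \<le> N" for n N y
      unfolding G_def using that by (intro max_affine_ge) auto
    have G_mono: "G m y \<le> G n y" if "m \<le> n" for m n y
    proof -
      obtain c h where "(c, h) \<in> a ` {..m}" "G m y = c + h \<bullet> y"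
        unfolding G_def by (rule max_affine_attained[of "a ` {..m}"]) auto
      then show ?thesis using that by (auto simp: G_def intro!: max_affine_ge)
    qed
    have g_le: "g y \<le> G N y" for N y
      using G_ge[of 0 N] by (simp add: g_def)
    have f_meas: "f \<in> borel_measurable borel"
      using f by (intro borel_measurable_continuous_onI convex_on_continuous) auto
    have G_meas: "G N \<in> borel_measurable borel" for N
      unfolding G_def by (intro max_affine_measurable) auto
    have SUP: "(SUP N. ennreal (G N y - g y)) = ennreal (f y - g y)" for y
    proof (rule antisym)
      show "(SUP N. ennreal (G N y - g y)) \<le> ennreal (f y - g y)"
        using G_le by (intro SUP_least ennreal_leI) auto
      show "ennreal (f y - g y) \<le> (SUP N. ennreal (G N y - g y))"
      proof (rule ennreal_le_epsilon)
        fix e :: real assume "0 < e"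
        then obtain n where "f y - e < fst (a n) + snd (a n) \<bullet> y" using sup[of "f y - e" y] by auto
        then have "f y - e < G n y" using G_ge[of n n y] by linarith
        moreover have "0 \<le> G n y - g y" using G_ge[of 0 n y] by (simp add: g_def)
        ultimately have "ennreal (f y - g y) \<le> ennreal (G n y - g y) + ennreal e"
          using \<open>0 < e\<close> by (simp add: ennreal_leI flip: ennreal_plus)
        also have "\<dots> \<le> (SUP N. ennreal (G N y - g y)) + ennreal e"
          by (intro add_right_mono SUP_upper) auto
        finally show "ennreal (f y - g y) \<le> (SUP N. ennreal (G N y - g y)) + ennreal e" .
      qed
    qed
    have g_int: "integrable \<rho> g" if "\<rho> \<in> P2" for \<rho>
      using P2_max_affine_integrable[OF that, of "{a 0}"]
      by (simp add: g_def[abs_def] max_affine_def[abs_def] case_prod_beta)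
    have G_int: "integrable \<rho> (G N)" if "\<rho> \<in> P2" for \<rho> N
      unfolding G_def using that by (intro P2_max_affine_integrable) auto
    have nn: "(\<integral>\<^sup>+y. ennreal (G N y - g y) \<partial>\<rho>) = ennreal ((\<integral>y. G N y \<partial>\<rho>) - (\<integral>y. g y \<partial>\<rho>))"
      if "\<rho> \<in> P2" for \<rho> N
      using G_int[OF that] g_int[OF that] g_le by (subst nn_integral_eq_integral) auto
    have g_eq: "(\<integral>y. g y \<partial>\<eta>) = (\<integral>y. g y \<partial>\<nu>)"
      unfolding g_def by (intro max_affine_test_affine le)
    have "(\<integral>\<^sup>+y. ennreal (f y - g y) \<partial>\<eta>) = (\<integral>\<^sup>+y. (SUP N. ennreal (G N y - g y)) \<partial>\<eta>)"
      by (simp add: SUP)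
    also have "\<dots> = (SUP N. \<integral>\<^sup>+y. ennreal (G N y - g y) \<partial>\<eta>)"
    proof (rule nn_integral_monotone_convergence_SUP)
      show "incseq (\<lambda>N y. ennreal (G N y - g y))"
        using G_mono by (auto simp: incseq_def le_fun_def intro!: ennreal_leI)
      show "(\<lambda>y. ennreal (G N y - g y)) \<in> borel_measurable \<eta>" for N
        using G_int[OF \<eta>] g_int[OF \<eta>] by (auto dest!: borel_measurable_integrable)
    qed
    also have "\<dots> \<le> (\<integral>\<^sup>+y. ennreal (f y - g y) \<partial>\<nu>)"
    proof (rule SUP_least)
      fix N
      have "(\<integral>\<^sup>+y. ennreal (G N y - g y) \<partial>\<eta>) \<le> (\<integral>\<^sup>+y. ennreal (G N y - g y) \<partial>\<nu>)"
        using le[of "a ` {..N}"] unfolding nn[OF \<eta>] nn[OF \<nu>]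
        by (intro ennreal_leI) (auto simp: g_eq G_def)
      also have "\<dots> \<le> (\<integral>\<^sup>+y. ennreal (f y - g y) \<partial>\<nu>)"
        using G_le by (intro nn_integral_mono ennreal_leI) auto
      finally show "(\<integral>\<^sup>+y. ennreal (G N y - g y) \<partial>\<eta>) \<le> (\<integral>\<^sup>+y. ennreal (f y - g y) \<partial>\<nu>)" .
    qed
    finally have *: "(\<integral>\<^sup>+y. ennreal (f y - g y) \<partial>\<eta>) \<le> (\<integral>\<^sup>+y. ennreal (f y - g y) \<partial>\<nu>)" .
    have "ext_integral \<rho> f = enn2ereal (\<integral>\<^sup>+y. ennreal (f y - g y) \<partial>\<rho>) + ereal (\<integral>y. g y \<partial>\<rho>)"
      if "\<rho> \<in> P2" for \<rho>
    proof (rule ext_integral_eq)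
      show "f \<in> borel_measurable \<rho>"
        using f_meas P2_sets[OF that] by (simp cong: measurable_cong_sets)
      show "g y \<le> f y" for y using a[of 0 y] by (simp add: g_def)
    qed (rule g_int[OF that])
    then show "ext_integral \<eta> f \<le> ext_integral \<nu> f"
      using * \<eta> \<nu> by (simp add: g_eq add_right_mono less_eq_ennreal.rep_eq)
  qed
qed

section \<open>Random vectors dominated by a measure\<close>

lemma P2_distr:
  fixes Z :: "'b \<Rightarrow> 'a::euclidean_space"
  assumes "prob_space M" "square_integrable M Z"
  shows "distr M borel Z \<in> P2"
  using assms prob_space.prob_space_distr[of M Z borel]
  by (auto simp: P2_def square_integrable_def integrable_distr_eq)

text \<open>The dictionary between maps and their laws: a change of variables in
  \<open>convex_order_iff_max_affine\<close>.\<close>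

lemma dominated_iff_convex_order:
  fixes Z :: "'b \<Rightarrow> 'a::euclidean_space"
  assumes "prob_space M" "square_integrable M Z" "\<nu> \<in> P2"
  shows "dominated M Z \<nu> \<longleftrightarrow> distr M borel Z \<le>\<^sub>c\<^sub>x \<nu>"
  using assms P2_distr[OF assms(1,2)] square_integrable_measurable[OF assms(2)]
  by (auto simp: convex_order_iff_max_affine dominated_def integral_distr max_affine_measurable)

lemma dominated_distr:
  fixes Z :: "'b \<Rightarrow> 'a::euclidean_space"
  assumes [measurable]: "X \<in> measurable M N" and [measurable]: "Z \<in> borel_measurable N"
  shows "dominated (distr M N X) Z \<nu> \<longleftrightarrow> dominated M (\<lambda>x. Z (X x)) \<nu>"
  by (simp add: dominated_def square_integrable_distr integral_distr
      measurable_compose[OF _ max_affine_measurable] cong: conj_cong)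

text \<open>Coordinates are affine. Two maps dominated by the same measure therefore differ by a map
  of mean zero, which is the source of all centering below.\<close>

lemma dominated_mean:
  fixes Z :: "'b \<Rightarrow> 'a::euclidean_space"
  assumes "prob_space M" "dominated M Z \<nu>" "\<nu> \<in> P2"
  shows "(\<integral>x. Z x \<partial>M) = mean \<nu>"
proof (rule euclidean_eqI)
  fix b :: 'a assume "b \<in> Basis"
  interpret prob_space M by fact
  interpret n: prob_space \<nu> using assms(3) by (rule P2_prob_space)
  have "(\<integral>x. 0 + b \<bullet> Z x \<partial>M) = (\<integral>x. 0 + b \<bullet> x \<partial>\<nu>)"
    using assms by (intro max_affine_test_affine dominatedD)
  then show "(\<integral>x. Z x \<partial>M) \<bullet> b = mean \<nu> \<bullet> b"
    using square_integrable_integrable[OF dominated_square_integrable[OF assms(2)]]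
      n.square_integrable_integrable[OF P2_square_integrable[OF assms(3)]]
    by (simp add: mean_def inner_commute[of _ b])
qed

text \<open>The combination is taken pointwise on a common space, not between laws, so convexity of
  each test function suffices.\<close>

lemma dominated_convex:
  assumes "prob_space M" "dominated M Z \<nu>" "dominated M W \<nu>" "0 \<le> a" "0 \<le> b" "a + b = 1"
  shows "dominated M (\<lambda>x. a *\<^sub>R Z x + b *\<^sub>R W x) \<nu>"
  unfolding dominated_def
proof (intro conjI allI impI)
  interpret prob_space M by fact
  note sq = dominated_square_integrable[OF assms(2)] dominated_square_integrable[OF assms(3)]
  show *: "square_integrable M (\<lambda>x. a *\<^sub>R Z x + b *\<^sub>R W x)"
    by (intro square_integrable_add square_integrable_scaleR sq)
  fix F :: "(real \<times> 'b) set" assume F: "finite F" "F \<noteq> {}"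
  note int = sq[THEN max_affine_integrable[OF _ F]]
  have "(\<integral>x. max_affine F (a *\<^sub>R Z x + b *\<^sub>R W x) \<partial>M)
    \<le> (\<integral>x. a * max_affine F (Z x) + b * max_affine F (W x) \<partial>M)"
    using int by (intro integral_mono max_affine_integrable * F max_affine_convex assms) auto
  also have "\<dots> = a * (\<integral>x. max_affine F (Z x) \<partial>M) + b * (\<integral>x. max_affine F (W x) \<partial>M)"
    using int by simp
  also have "\<dots> \<le> a * (\<integral>y. max_affine F y \<partial>\<nu>) + b * (\<integral>y. max_affine F y \<partial>\<nu>)"
    using assms F by (intro add_mono mult_left_mono dominatedD) auto
  also have "\<dots> = (\<integral>y. max_affine F y \<partial>\<nu>)"
    using assms(6) by (simp flip: distrib_right)
  finally show "(\<integral>x. max_affine F (a *\<^sub>R Z x + b *\<^sub>R W x) \<partial>M) \<le> (\<integral>y. max_affine F y \<partial>\<nu>)" .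
qed

section \<open>Averaging a random vector over a finite partition\<close>

text \<open>A conditional expectation with respect to finitely many events of \<^term>\<open>N\<close>, transported from
  \<^term>\<open>M\<close> by a coupling of which only the weights \<^term>\<open>g j\<close> (the conditional
  probability of the event \<^term>\<open>\<kappa> = j\<close>) are recorded.\<close>

locale averaging = M: prob_space M + N: prob_space N
  for M :: "'b measure" and N :: "'c measure" +
  fixes J :: "'i set" and \<kappa> :: "'c \<Rightarrow> 'i" and g :: "'i \<Rightarrow> 'b \<Rightarrow> real"
  assumes finite_J: "finite J"
    and \<kappa>_measurable [measurable]: "\<kappa> \<in> measurable N (count_space UNIV)"
    and \<kappa>_in_J: "AE x in N. \<kappa> x \<in> J"
    and mass_pos: "j \<in> J \<Longrightarrow> 0 < measure N {x \<in> space N. \<kappa> x = j}"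
    and g_measurable: "j \<in> J \<Longrightarrow> g j \<in> borel_measurable M"
    and g_nonneg: "j \<in> J \<Longrightarrow> 0 \<le> g j y"
    and g_sum: "AE y in M. (\<Sum>j\<in>J. g j y) = 1"
    and g_mass: "j \<in> J \<Longrightarrow> (\<integral>y. g j y \<partial>M) = measure N {x \<in> space N. \<kappa> x = j}"
begin

definition mass :: "'i \<Rightarrow> real" where
  "mass j = measure N {x \<in> space N. \<kappa> x = j}"

text \<open>The conditional barycenter of \<open>Z\<close> with respect to the weight
  \<open>g j\<close>. For \<open>j\<close> in \<open>J\<close> the divisor is positive, as null
  cells are left out of \<open>J\<close>.\<close>

definition cell_avg :: "('b \<Rightarrow> 'a::euclidean_space) \<Rightarrow> 'i \<Rightarrow> 'a" where
  "cell_avg Z j = (1 / mass j) *\<^sub>R (\<integral>y. g j y *\<^sub>R Z y \<partial>M)"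

definition avg :: "('b \<Rightarrow> 'a::euclidean_space) \<Rightarrow> 'c \<Rightarrow> 'a" where
  "avg Z x = cell_avg Z (\<kappa> x)"

lemma mass_gt_0: "j \<in> J \<Longrightarrow> 0 < mass j"
  by (simp add: mass_def mass_pos)

lemma compose_\<kappa>_measurable: "(\<lambda>x. \<psi> (\<kappa> x)) \<in> borel_measurable N"
  by (rule measurable_compose[OF \<kappa>_measurable]) simp

lemma has_bochner_integral_\<kappa>:
  fixes \<psi> :: "'i \<Rightarrow> 'a::euclidean_space"
  shows "has_bochner_integral N (\<lambda>x. \<psi> (\<kappa> x)) (\<Sum>j\<in>J. mass j *\<^sub>R \<psi> j)"
proof -
  have "has_bochner_integral N (\<lambda>x. \<Sum>j\<in>J. indicat_real {x \<in> space N. \<kappa> x = j} x *\<^sub>R \<psi> j)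
      (\<Sum>j\<in>J. mass j *\<^sub>R \<psi> j)"
    unfolding mass_def
    by (intro has_bochner_integral_sum has_bochner_integral_scaleR_left has_bochner_integral_real_indicator)
      (auto simp: N.emeasure_eq_measure)
  moreover have "AE x in N. (\<Sum>j\<in>J. indicat_real {x \<in> space N. \<kappa> x = j} x *\<^sub>R \<psi> j) = \<psi> (\<kappa> x)"
    using \<kappa>_in_J AE_space
  proof eventually_elim
    fix x assume x: "\<kappa> x \<in> J" "x \<in> space N"
    have "(\<Sum>j\<in>J. indicat_real {x \<in> space N. \<kappa> x = j} x *\<^sub>R \<psi> j)
        = (\<Sum>j\<in>J. if j = \<kappa> x then \<psi> j else 0)"
      using x by (intro sum.cong) (auto simp: indicator_def)
    then show "(\<Sum>j\<in>J. indicat_real {x \<in> space N. \<kappa> x = j} x *\<^sub>R \<psi> j) = \<psi> (\<kappa> x)"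
      using x finite_J by simp
  qed
  ultimately show ?thesis
    by (subst (asm) has_bochner_integral_cong_AE)
      (auto intro: compose_\<kappa>_measurable)
qed

lemma integrable_\<kappa>: "integrable N (\<lambda>x. \<psi> (\<kappa> x) :: 'a::euclidean_space)"
  and integral_\<kappa>: "(\<integral>x. \<psi> (\<kappa> x) \<partial>N) = (\<Sum>j\<in>J. mass j *\<^sub>R \<psi> j)"
  using has_bochner_integral_\<kappa>[of \<psi>] by (auto simp: has_bochner_integral_iff)

lemma sum_mass: "(\<Sum>j\<in>J. mass j) = 1"
  using integral_\<kappa>[of "\<lambda>_. 1 :: real"] by (simp add: N.prob_space)

lemma square_integrable_\<kappa>: "square_integrable N (\<lambda>x. \<psi> (\<kappa> x))"
  using integrable_\<kappa>[of "\<lambda>j. (norm (\<psi> j))\<^sup>2"]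
  by (simp add: square_integrable_def compose_\<kappa>_measurable)

lemma g_le_1: "j \<in> J \<Longrightarrow> AE y in M. g j y \<le> 1"
  using g_sum
proof eventually_elim
  fix y assume "j \<in> J" "(\<Sum>j\<in>J. g j y) = 1"
  then show "g j y \<le> 1"
    using member_le_sum[of j J "\<lambda>j. g j y"] g_nonneg finite_J by auto
qed

lemma integrable_g_scaleR:
  fixes f :: "'b \<Rightarrow> 'a::euclidean_space"
  assumes "j \<in> J" "integrable M f"
  shows "integrable M (\<lambda>y. g j y *\<^sub>R f y)"
proof (rule Bochner_Integration.integrable_bound[OF assms(2)])
  show "(\<lambda>y. g j y *\<^sub>R f y) \<in> borel_measurable M"
    using assms g_measurable[of j] by (auto dest: borel_measurable_integrable)
  show "AE y in M. norm (g j y *\<^sub>R f y) \<le> norm (f y)"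
    using g_le_1[OF assms(1)]
    by eventually_elim (use g_nonneg[OF assms(1)] in \<open>auto simp: mult_left_le_one_le\<close>)
qed

lemma integrable_g: "j \<in> J \<Longrightarrow> integrable M (g j)"
  using integrable_g_scaleR[of j "\<lambda>_. 1::real"] by simp

lemma sum_integral_g:
  fixes f :: "'b \<Rightarrow> real"
  assumes "integrable M f"
  shows "(\<Sum>j\<in>J. \<integral>y. g j y * f y \<partial>M) = (\<integral>y. f y \<partial>M)"
proof -
  note int = integrable_g_scaleR[OF _ assms, simplified]
  have "(\<Sum>j\<in>J. \<integral>y. g j y * f y \<partial>M) = (\<integral>y. (\<Sum>j\<in>J. g j y * f y) \<partial>M)"
    using int by (intro Bochner_Integration.integral_sum[symmetric]) auto
  also have "\<dots> = (\<integral>y. f y \<partial>M)"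
  proof (rule integral_cong_AE)
    show "(\<lambda>y. \<Sum>j\<in>J. g j y * f y) \<in> borel_measurable M"
      using int by (intro borel_measurable_integrable Bochner_Integration.integrable_sum) auto
    show "f \<in> borel_measurable M" using assms by auto
    show "AE y in M. (\<Sum>j\<in>J. g j y * f y) = f y"
      using g_sum by eventually_elim (simp flip: sum_distrib_right)
  qed
  finally show ?thesis .
qed

text \<open>The constant \<open>c\<close> is reproduced only because \<open>g_mass\<close> is an
  equality. For this reason weights with approximate masses are corrected by
  \<open>unity_partition_exact_mass\<close> before they are used.\<close>

lemma mass_affine_cell_avg:
  assumes "integrable M Z" "j \<in> J"
  shows "mass j * (c + h \<bullet> cell_avg Z j) = (\<integral>y. g j y * (c + h \<bullet> Z y) \<partial>M)"
proof -
  have "integrable M (\<lambda>y. g j y *\<^sub>R Z y)"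
    using assms by (intro integrable_g_scaleR)
  then have "(\<integral>y. g j y * (c + h \<bullet> Z y) \<partial>M) = c * (\<integral>y. g j y \<partial>M) + h \<bullet> (\<integral>y. g j y *\<^sub>R Z y \<partial>M)"
    using integrable_g[OF assms(2)] integrable_inner_right[of h M "\<lambda>y. g j y *\<^sub>R Z y"]
    by (simp add: algebra_simps integral_inner_right[symmetric] del: integral_inner_right)
  also have "\<dots> = c * mass j + h \<bullet> (mass j *\<^sub>R cell_avg Z j)"
    using mass_gt_0[OF assms(2)] g_mass[OF assms(2)] by (simp add: cell_avg_def mass_def[symmetric])
  finally show ?thesis by (simp add: algebra_simps)
qed

text \<open>On each cell \<open>\<phi>\<close> is replaced by its supporting affine function at the
  cell average; affine functions pass through the average, and the weights \<open>g j\<close> sum to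
  1.\<close>

lemma jensen_avg:
  fixes \<phi> :: "'a::euclidean_space \<Rightarrow> real"
  assumes Z: "integrable M Z" and \<phi>Z: "integrable M (\<lambda>y. \<phi> (Z y))"
    and subgradient: "\<And>v. \<exists>c h. \<phi> v = c + h \<bullet> v \<and> (\<forall>z. c + h \<bullet> z \<le> \<phi> z)"
  shows "(\<integral>x. \<phi> (avg Z x) \<partial>N) \<le> (\<integral>y. \<phi> (Z y) \<partial>M)"
proof -
  have "(\<integral>x. \<phi> (avg Z x) \<partial>N) = (\<Sum>j\<in>J. mass j * \<phi> (cell_avg Z j))"
    unfolding avg_def by (subst integral_\<kappa>[of "\<lambda>j. \<phi> (cell_avg Z j)"]) simp
  also have "\<dots> \<le> (\<Sum>j\<in>J. \<integral>y. g j y * \<phi> (Z y) \<partial>M)"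
  proof (rule sum_mono)
    fix j assume j: "j \<in> J"
    obtain c h where ch: "\<phi> (cell_avg Z j) = c + h \<bullet> cell_avg Z j" "\<And>z. c + h \<bullet> z \<le> \<phi> z"
      using subgradient by metis
    have "mass j * \<phi> (cell_avg Z j) = (\<integral>y. g j y * (c + h \<bullet> Z y) \<partial>M)"
      unfolding ch(1) by (rule mass_affine_cell_avg[OF Z j])
    also have "\<dots> \<le> (\<integral>y. g j y * \<phi> (Z y) \<partial>M)"
      using integrable_g_scaleR[OF j, of "\<lambda>y. c + h \<bullet> Z y"] integrable_g_scaleR[OF j \<phi>Z] Z
      by (intro integral_mono mult_left_mono g_nonneg j ch) auto
    finally show "mass j * \<phi> (cell_avg Z j) \<le> (\<integral>y. g j y * \<phi> (Z y) \<partial>M)" .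
  qed
  also have "\<dots> = (\<integral>y. \<phi> (Z y) \<partial>M)" by (rule sum_integral_g[OF \<phi>Z])
  finally show ?thesis .
qed

lemma avg_square_integrable: "square_integrable N (avg Z)"
  unfolding avg_def by (rule square_integrable_\<kappa>)

lemma avg_l2norm_le:
  assumes "square_integrable M Z"
  shows "l2norm N (avg Z) \<le> l2norm M Z"
  unfolding l2norm_def
proof (intro real_sqrt_le_mono jensen_avg)
  show "integrable M Z" using assms by (rule M.square_integrable_integrable)
  show "integrable M (\<lambda>y. (norm (Z y))\<^sup>2)" using assms by (rule square_integrableD)
  fix v :: 'a
  \<comment> \<open>The tangent of the squared norm at \<open>v\<close>; the inequality is the
    expansion of the squared norm of \<open>z - v\<close>.\<close>
  have "- (v \<bullet> v) + 2 *\<^sub>R v \<bullet> z \<le> (norm z)\<^sup>2" for z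
    using zero_le_power2[of "norm (z - v)"] unfolding norm_diff_power2
    by (simp add: power2_norm_eq_inner inner_commute)
  moreover have "(norm v)\<^sup>2 = - (v \<bullet> v) + 2 *\<^sub>R v \<bullet> v"
    by (simp add: power2_norm_eq_inner)
  ultimately show "\<exists>c h. (norm v)\<^sup>2 = c + h \<bullet> v \<and> (\<forall>z. c + h \<bullet> z \<le> (norm z)\<^sup>2)"
    by blast
qed

text \<open>The affine piece that attains the maximum is a subgradient, so Jensen's inequality
  applies. In this way a dominated coordinate of a coupling yields a dominated map on
  \<open>N\<close>.\<close>

lemma avg_dominated:
  assumes "dominated M Z \<nu>"
  shows "dominated N (avg Z) \<nu>"
  unfolding dominated_def
proof (intro conjI allI impI avg_square_integrable)
  fix F :: "(real \<times> 'a) set" assume F: "finite F" "F \<noteq> {}"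
  note Z = dominated_square_integrable[OF assms]
  have "(\<integral>x. max_affine F (avg Z x) \<partial>N) \<le> (\<integral>y. max_affine F (Z y) \<partial>M)"
  proof (rule jensen_avg)
    fix v :: 'a
    show "\<exists>c h. max_affine F v = c + h \<bullet> v \<and> (\<forall>z. c + h \<bullet> z \<le> max_affine F z)"
      using F by (metis max_affine_attained max_affine_ge)
  qed (use Z F in \<open>auto intro: M.square_integrable_integrable M.max_affine_integrable\<close>)
  also have "\<dots> \<le> (\<integral>y. max_affine F y \<partial>\<nu>)" using assms F by (rule dominatedD)
  finally show "(\<integral>x. max_affine F (avg Z x) \<partial>N) \<le> (\<integral>y. max_affine F y \<partial>\<nu>)" .
qed

lemma avg_diff_ae:
  assumes "integrable M Z" "integrable M W"
  shows "AE x in N. avg (\<lambda>y. Z y - W y) x = avg Z x - avg W x"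
  using \<kappa>_in_J
proof eventually_elim
  fix x assume "\<kappa> x \<in> J"
  then show "avg (\<lambda>y. Z y - W y) x = avg Z x - avg W x"
    using integrable_g_scaleR[OF _ assms(1)] integrable_g_scaleR[OF _ assms(2)]
    by (simp add: avg_def cell_avg_def scaleR_diff_right)
qed

lemma avg_l2norm_diff_le:
  fixes Z W :: "'b \<Rightarrow> 'd::euclidean_space"
  assumes "square_integrable M Z" "square_integrable M W"
  shows "l2norm N (\<lambda>x. avg Z x - avg W x) \<le> l2norm M (\<lambda>y. Z y - W y)"
proof -
  have [measurable]: "avg V \<in> borel_measurable N" for V :: "'b \<Rightarrow> 'd"
    by (intro square_integrable_measurable avg_square_integrable)
  have "l2norm N (\<lambda>x. avg Z x - avg W x) = l2norm N (avg (\<lambda>y. Z y - W y))"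
    unfolding l2norm_def
  proof (intro arg_cong[where f=sqrt] integral_cong_AE)
    show "AE x in N. (norm (avg Z x - avg W x))\<^sup>2 = (norm (avg (\<lambda>y. Z y - W y) x))\<^sup>2"
      using avg_diff_ae[OF assms[THEN M.square_integrable_integrable]]
      by eventually_elim simp
  qed measurable
  also have "\<dots> \<le> l2norm M (\<lambda>y. Z y - W y)"
    by (intro avg_l2norm_le square_integrable_diff assms)
  finally show ?thesis .
qed

end

section \<open>Averages over the fibres of a simple function\<close>

lemma (in prob_space) simple_function_AE_positive_fibres:
  assumes R: "simple_function M R"
  defines "J \<equiv> {r \<in> R ` space M. 0 < prob {x \<in> space M. R x = r}}"
  shows "finite J" "AE x in M. R x \<in> J"
proof -
  have fin: "finite (R ` space M)" using R by (rule simple_functionD(1))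
  then show "finite J" by (simp add: J_def)
  have "AE x in M. \<forall>r\<in>R ` space M - J. R x \<noteq> r"
  proof (rule AE_finite_allI)
    show "finite (R ` space M - J)" using fin by simp
    fix r assume r: "r \<in> R ` space M - J"
    have "{x \<in> space M. R x = r} \<in> events"
      using simple_functionD(2)[OF R, of "{r}"] by (simp add: vimage_def Int_def conj_commute)
    then show "AE x in M. R x \<noteq> r"
      using r by (intro AE_I'[of "{x \<in> space M. R x = r}"])
        (auto simp: J_def null_sets_def emeasure_eq_measure not_less intro: antisym)
  qed
  then show "AE x in M. R x \<in> J" by (auto simp: eventually_mono[OF AE_space] elim!: AE_mp)
qed

text \<open>With indicator weights the average is the conditional expectation on \<open>M\<close>
  given \<open>R\<close> composed with \<open>X\<close>, read as a function on \<open>N\<close>, the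
  law of \<open>X\<close>.\<close>

lemma averaging_pullback:
  assumes M: "prob_space M" and X [measurable]: "X \<in> measurable M N" and N: "distr M N X = N"
    and R: "simple_function N R"
  shows "averaging M N {r \<in> R ` space N. 0 < measure N {x \<in> space N. R x = r}} R
    (\<lambda>r y. indicat_real {r} (R (X y)))"
proof -
  interpret M: prob_space M by fact
  interpret N: prob_space N using M.prob_space_distr[OF X] by (simp add: N)
  have R_meas [measurable]: "R \<in> measurable N (count_space UNIV)"
    using R by (rule measurable_simple_function)
  define J where "J = {r \<in> R ` space N. 0 < measure N {x \<in> space N. R x = r}}"
  note J = N.simple_function_AE_positive_fibres[OF R, folded J_def]
  have "averaging M N J R (\<lambda>r y. indicat_real {r} (R (X y)))"
  proof
    show "finite J" by (rule J)
    show "AE x in N. R x \<in> J" by (rule J)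
    show "AE y in M. (\<Sum>j\<in>J. indicat_real {j} (R (X y))) = 1"
    proof -
      have "AE x in distr M N X. R x \<in> J" unfolding N by (rule J(2))
      then have "AE y in M. R (X y) \<in> J" by (rule AE_distrD[OF X])
      then show ?thesis
        by eventually_elim (use J(1) in \<open>simp add: indicator_def\<close>)
    qed
    fix j assume "j \<in> J"
    then show "0 < measure N {x \<in> space N. R x = j}" by (simp add: J_def)
    show "(\<lambda>y. indicat_real {j} (R (X y))) \<in> borel_measurable M"
      by (rule measurable_compose[OF measurable_compose[OF X R_meas]]) simp
    have "(\<integral>y. indicat_real {j} (R (X y)) \<partial>M) = (\<integral>x. indicat_real {j} (R x) \<partial>distr M N X)"
      by (rule integral_distr[symmetric, OF X], rule measurable_compose[OF R_meas]) simp
    also have "\<dots> = (\<integral>x. indicat_real {x \<in> space N. R x = j} x \<partial>N)"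
      unfolding N by (intro Bochner_Integration.integral_cong) (auto simp: indicator_def)
    finally show "(\<integral>y. indicat_real {j} (R (X y)) \<partial>M) = measure N {x \<in> space N. R x = j}"
      by simp
  qed auto
  then show ?thesis by (simp add: J_def)
qed

text \<open>An averaging reproduces the functions of the partition, and it contracts, so it moves
  a random vector at most twice as far as the approximation it is built from.\<close>

lemma averaging_pullback_close:
  fixes R T :: "'c \<Rightarrow> 'a::euclidean_space"
  assumes M: "prob_space M" and X [measurable]: "X \<in> measurable M N" and N: "distr M N X = N"
    and R: "simple_function N R" "square_integrable N R" and T: "square_integrable N T"
  defines "A \<equiv> averaging.avg M N R (\<lambda>r y. indicat_real {r} (R (X y))) (\<lambda>y. T (X y))"
  shows "l2norm N (\<lambda>x. T x - A x) \<le> 2 * l2norm N (\<lambda>x. T x - R x)"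
proof -
  define J where "J = {r \<in> R ` space N. 0 < measure N {x \<in> space N. R x = r}}"
  interpret averaging M N J R "\<lambda>r y. indicat_real {r} (R (X y))"
    unfolding J_def by (rule averaging_pullback[OF M X N R(1)])
  have [measurable]: "R \<in> borel_measurable N" "T \<in> borel_measurable N"
    using R T by (auto intro: square_integrable_measurable)
  have [measurable]: "avg V \<in> borel_measurable N" for V :: "'b \<Rightarrow> 'a"
    by (intro square_integrable_measurable avg_square_integrable)
  have TX: "square_integrable M (\<lambda>y. T (X y))" and RX: "square_integrable M (\<lambda>y. R (X y))"
    using R(2) T square_integrable_distr[OF X, of R] square_integrable_distr[OF X, of T]
    by (auto simp: N)
  have fix_R: "AE x in N. avg (\<lambda>y. R (X y)) x = R x"
    using \<kappa>_in_J
  proof eventually_elim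
    fix x assume x: "R x \<in> J"
    have "(\<integral>y. indicat_real {R x} (R (X y)) *\<^sub>R R (X y) \<partial>M)
        = (\<integral>y. indicat_real {R x} (R (X y)) *\<^sub>R R x \<partial>M)"
      by (intro Bochner_Integration.integral_cong) (auto simp: indicator_def)
    also have "\<dots> = mass (R x) *\<^sub>R R x"
      using integrable_g[OF x] g_mass[OF x] by (simp add: mass_def)
    finally show "avg (\<lambda>y. R (X y)) x = R x"
      using mass_gt_0[OF x] by (simp add: avg_def cell_avg_def)
  qed
  have "l2norm N (\<lambda>x. R x - A x) = l2norm N (\<lambda>x. avg (\<lambda>y. R (X y)) x - avg (\<lambda>y. T (X y)) x)"
    unfolding l2norm_def A_def
  proof (intro arg_cong[where f=sqrt] integral_cong_AE)
    show "AE x in N. (norm (R x - avg (\<lambda>y. T (X y)) x))\<^sup>2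
        = (norm (avg (\<lambda>y. R (X y)) x - avg (\<lambda>y. T (X y)) x))\<^sup>2"
      using fix_R by eventually_elim simp
  qed measurable
  also have "\<dots> \<le> l2norm M (\<lambda>y. R (X y) - T (X y))"
    by (intro avg_l2norm_diff_le RX TX)
  also have "\<dots> = l2norm N (\<lambda>x. T x - R x)"
    using l2norm_distr[OF X, of "\<lambda>x. R x - T x"] by (simp add: N l2norm_minus_commute[of N R])
  finally show ?thesis
    using l2norm_triangle[OF T R(2) avg_square_integrable[of "\<lambda>y. T (X y)"]] by (simp add: A_def)
qed

section \<open>Projection onto the dominated random vectors\<close>

text \<open>The geometric rate makes the sum of the increments' norms integrable, hence finite
  almost everywhere, so the telescoping series converges absolutely there.\<close>

lemma (in finite_measure) l2norm_Cauchy_AE_limit: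
  fixes T :: "nat \<Rightarrow> 'a \<Rightarrow> 'b::euclidean_space"
  assumes L1: "\<And>n. (\<integral>x. norm (T (Suc n) x - T n x) \<partial>M) \<le> (1/2) ^ n"
    and T: "\<And>n. square_integrable M (T n)"
  obtains S where "S \<in> borel_measurable M" "AE x in M. (\<lambda>n. T n x) \<longlonglongrightarrow> S x"
proof -
  have [measurable]: "T n \<in> borel_measurable M" for n
    using T by (rule square_integrable_measurable)
  define S where "S x = lim (\<lambda>n. T n x)" for x
  have [measurable]: "S \<in> borel_measurable M"
    unfolding S_def by (rule borel_measurable_lim_metric) measurable
  have int: "integrable M (\<lambda>x. norm (T (Suc n) x - T n x))" for n
    using T by (intro integrable_norm square_integrable_integrable square_integrable_diff)
  have "(\<integral>\<^sup>+x. (\<Sum>n. ennreal (norm (T (Suc n) x - T n x))) \<partial>M)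
      = (\<Sum>n. \<integral>\<^sup>+x. ennreal (norm (T (Suc n) x - T n x)) \<partial>M)"
    by (intro nn_integral_suminf) measurable
  also have "\<dots> = (\<Sum>n. ennreal (\<integral>x. norm (T (Suc n) x - T n x) \<partial>M))"
    using int by (intro suminf_cong nn_integral_eq_integral) auto
  also have "\<dots> \<le> (\<Sum>n. ennreal ((1/2) ^ n))"
    by (intro suminf_le ennreal_leI L1) auto
  also have "\<dots> = ennreal (\<Sum>n. (1/2) ^ n)"
    by (intro suminf_ennreal2) (auto intro: summable_geometric)
  also have "\<dots> < \<infinity>" by simp
  finally have "(\<integral>\<^sup>+x. (\<Sum>n. ennreal (norm (T (Suc n) x - T n x))) \<partial>M) \<noteq> \<infinity>"
    by simp
  then have "AE x in M. (\<Sum>n. ennreal (norm (T (Suc n) x - T n x))) \<noteq> \<infinity>"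
    by (intro nn_integral_PInf_AE) measurable
  then have "AE x in M. (\<lambda>n. T n x) \<longlonglongrightarrow> S x"
  proof eventually_elim
    fix x assume "(\<Sum>n. ennreal (norm (T (Suc n) x - T n x))) \<noteq> \<infinity>"
    then have "summable (\<lambda>n. norm (T (Suc n) x - T n x))"
      by (intro summable_suminf_not_top) auto
    then have "summable (\<lambda>n. T (Suc n) x - T n x)"
      by (rule summable_norm_cancel)
    then have "convergent (\<lambda>n. \<Sum>i<n. T (Suc i) x - T i x)"
      by (simp add: summable_iff_convergent)
    then have "convergent (\<lambda>n. T n x - T 0 x)"
      using sum_lessThan_telescope[of "\<lambda>n. T n x"] by simp
    then have "convergent (\<lambda>n. (T n x - T 0 x) + T 0 x)"
      by (intro convergent_add convergent_const)
    then show "(\<lambda>n. T n x) \<longlonglongrightarrow> S x"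
      by (simp add: S_def convergent_LIMSEQ_iff)
  qed
  then show ?thesis by (intro that) auto
qed

lemma (in prob_space) square_integrable_Fatou:
  fixes T :: "nat \<Rightarrow> 'a \<Rightarrow> 'b::euclidean_space"
  assumes T: "\<And>n. square_integrable M (T n)" and S: "S \<in> borel_measurable M"
    and lim: "AE x in M. (\<lambda>n. T n x) \<longlonglongrightarrow> S x"
    and bound: "\<And>n. l2norm M (T n) \<le> b n" and b: "b \<longlonglongrightarrow> B"
  shows "square_integrable M S" "l2norm M S \<le> B"
proof -
  have [measurable]: "T n \<in> borel_measurable M" for n
    using T by (rule square_integrable_measurable)
  note S[measurable]
  have b0: "0 \<le> b n" for n using bound[of n] l2norm_nonneg[of M "T n"] by linarith
  have B0: "0 \<le> B" using b0 b by (intro LIMSEQ_le_const) auto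
  have "(\<integral>\<^sup>+x. ennreal ((norm (S x))\<^sup>2) \<partial>M) = (\<integral>\<^sup>+x. liminf (\<lambda>n. ennreal ((norm (T n x))\<^sup>2)) \<partial>M)"
    using lim
  proof (intro nn_integral_cong_AE, eventually_elim)
    fix x assume "(\<lambda>n. T n x) \<longlonglongrightarrow> S x"
    then have "(\<lambda>n. ennreal ((norm (T n x))\<^sup>2)) \<longlonglongrightarrow> ennreal ((norm (S x))\<^sup>2)"
      by (intro tendsto_intros tendsto_ennrealI)
    then show "ennreal ((norm (S x))\<^sup>2) = liminf (\<lambda>n. ennreal ((norm (T n x))\<^sup>2))"
      by (intro lim_imp_Liminf[symmetric]) auto
  qed
  also have "\<dots> \<le> liminf (\<lambda>n. \<integral>\<^sup>+x. ennreal ((norm (T n x))\<^sup>2) \<partial>M)"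
    by (rule nn_integral_liminf) measurable
  also have "\<dots> \<le> liminf (\<lambda>n. ennreal ((b n)\<^sup>2))"
  proof (rule Liminf_mono, rule always_eventually, rule allI)
    fix n
    have "(\<integral>\<^sup>+x. ennreal ((norm (T n x))\<^sup>2) \<partial>M) = ennreal ((l2norm M (T n))\<^sup>2)"
      unfolding l2norm_power2 using square_integrableD[OF T] by (intro nn_integral_eq_integral) auto
    also have "\<dots> \<le> ennreal ((b n)\<^sup>2)"
      by (intro ennreal_leI power_mono bound) simp
    finally show "(\<integral>\<^sup>+x. ennreal ((norm (T n x))\<^sup>2) \<partial>M) \<le> ennreal ((b n)\<^sup>2)" .
  qed
  also have "\<dots> = ennreal (B\<^sup>2)"
    using b by (intro lim_imp_Liminf tendsto_ennrealI tendsto_intros) auto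
  finally have le: "(\<integral>\<^sup>+x. ennreal ((norm (S x))\<^sup>2) \<partial>M) \<le> ennreal (B\<^sup>2)" .
  then have int: "integrable M (\<lambda>x. (norm (S x))\<^sup>2)"
    by (intro integrableI_bounded) (auto simp: order_le_less_trans[OF _ ennreal_less_top])
  then show "square_integrable M S" by (simp add: square_integrable_def)
  have "ennreal ((l2norm M S)\<^sup>2) \<le> ennreal (B\<^sup>2)"
    using le int by (simp add: l2norm_power2 nn_integral_eq_integral)
  then have "(l2norm M S)\<^sup>2 \<le> B\<^sup>2" by simp
  then show "l2norm M S \<le> B" using B0 by (rule power2_le_imp_le)
qed

text \<open>A finite maximum of affine functions is Lipschitz and the first absolute moment is at
  most the \<open>l2norm\<close>, so each test integral is continuous along the sequence.\<close>

lemma (in prob_space) dominated_closed: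
  fixes T :: "nat \<Rightarrow> 'a \<Rightarrow> 'b::euclidean_space"
  assumes T: "\<And>n. dominated M (T n) \<nu>" and S: "square_integrable M S"
    and lim: "(\<lambda>n. l2norm M (\<lambda>x. S x - T n x)) \<longlonglongrightarrow> 0"
  shows "dominated M S \<nu>"
  unfolding dominated_def
proof (intro conjI allI impI S)
  fix F :: "(real \<times> 'b) set" assume F: "finite F" "F \<noteq> {}"
  let ?L = "\<Sum>(c, h)\<in>F. norm h"
  have L: "0 \<le> ?L" by (auto intro!: sum_nonneg)
  have "(\<integral>x. max_affine F (S x) \<partial>M) \<le> (\<integral>y. max_affine F y \<partial>\<nu>) + ?L * l2norm M (\<lambda>x. S x - T n x)" for n
  proof -
    note Tn = dominated_square_integrable[OF T[of n]]
    have diff: "square_integrable M (\<lambda>x. S x - T n x)"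
      using S Tn by (rule square_integrable_diff)
    have "(\<integral>x. max_affine F (S x) \<partial>M) \<le> (\<integral>x. max_affine F (T n x) + ?L * norm (S x - T n x) \<partial>M)"
    proof (rule integral_mono)
      fix x show "max_affine F (S x) \<le> max_affine F (T n x) + ?L * norm (S x - T n x)"
        using max_affine_lipschitz[OF F, of "S x" "T n x"] by linarith
    qed (use max_affine_integrable[OF S F] max_affine_integrable[OF Tn F]
        square_integrable_integrable[OF diff] in auto)
    also have "\<dots> = (\<integral>x. max_affine F (T n x) \<partial>M) + ?L * (\<integral>x. norm (S x - T n x) \<partial>M)"
      using max_affine_integrable[OF Tn F] square_integrable_integrable[OF diff] by simp
    also have "\<dots> \<le> (\<integral>y. max_affine F y \<partial>\<nu>) + ?L * l2norm M (\<lambda>x. S x - T n x)"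
      using L by (intro add_mono mult_left_mono dominatedD[OF T F] expectation_norm_le_l2norm diff)
    finally show ?thesis .
  qed
  moreover have "(\<lambda>n. (\<integral>y. max_affine F y \<partial>\<nu>) + ?L * l2norm M (\<lambda>x. S x - T n x))
      \<longlonglongrightarrow> (\<integral>y. max_affine F y \<partial>\<nu>) + ?L * 0"
    by (intro tendsto_intros lim)
  ultimately show "(\<integral>x. max_affine F (S x) \<partial>M) \<le> (\<integral>y. max_affine F y \<partial>\<nu>)"
    by (intro LIMSEQ_le_const[of _ "(\<integral>y. max_affine F y \<partial>\<nu>) + ?L * 0", simplified]) auto
qed

text \<open>Jensen's inequality. It supplies the competitor that makes the set to be projected onto
  nonempty.\<close>

lemma (in prob_space) dominated_const_mean:
  assumes "\<nu> \<in> P2"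
  shows "dominated M (\<lambda>_. mean \<nu>) \<nu>"
  unfolding dominated_def
proof (intro conjI allI impI square_integrable_const)
  fix F :: "(real \<times> 'b) set" assume F: "finite F" "F \<noteq> {}"
  interpret n: prob_space \<nu> using assms by (rule P2_prob_space)
  have id: "integrable \<nu> (\<lambda>y. y)"
    using P2_square_integrable[OF assms] by (rule n.square_integrable_integrable)
  have "max_affine F (mean \<nu>) \<le> (\<integral>y. max_affine F y \<partial>\<nu>)"
  proof (rule max_affine_le[OF F])
    fix c h assume ch: "(c, h) \<in> F"
    have "c + h \<bullet> mean \<nu> = (\<integral>y. c + h \<bullet> y \<partial>\<nu>)"
      using id by (simp add: mean_def n.prob_space)
    also have "\<dots> \<le> (\<integral>y. max_affine F y \<partial>\<nu>)"
      using id F ch by (intro integral_mono P2_max_affine_integrable assms max_affine_ge) auto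
    finally show "c + h \<bullet> mean \<nu> \<le> (\<integral>y. max_affine F y \<partial>\<nu>)" .
  qed
  then show "(\<integral>x. max_affine F (mean \<nu>) \<partial>M) \<le> (\<integral>y. max_affine F y \<partial>\<nu>)"
    by (simp add: prob_space)
qed

text \<open>A predicate rather than a function: the minimizer is determined only up to null
  sets.\<close>

definition is_projection ::
    "'b measure \<Rightarrow> ('b \<Rightarrow> 'a::euclidean_space) \<Rightarrow> 'a measure \<Rightarrow> ('b \<Rightarrow> 'a) \<Rightarrow> bool" where
  "is_projection M X \<nu> T \<longleftrightarrow> dominated M T \<nu> \<and>
     (\<forall>S. dominated M S \<nu> \<longrightarrow> l2norm M (\<lambda>x. X x - T x) \<le> l2norm M (\<lambda>x. X x - S x))"

text \<open>The parallelogram identity for \<open>X - S\<close> and \<open>X - T\<close>. It turns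
  near-minimality of both into closeness of \<open>S\<close> and \<open>T\<close>, for existence as
  well as for uniqueness of projections.\<close>

lemma (in prob_space) l2norm_midpoint:
  assumes "square_integrable M X" "square_integrable M S" "square_integrable M T"
  shows "(l2norm M (\<lambda>x. X x - ((1/2) *\<^sub>R S x + (1/2) *\<^sub>R T x)))\<^sup>2
    = (l2norm M (\<lambda>x. X x - S x))\<^sup>2 / 2 + (l2norm M (\<lambda>x. X x - T x))\<^sup>2 / 2
      - (l2norm M (\<lambda>x. S x - T x))\<^sup>2 / 4"
proof -
  have "X x - ((1/2) *\<^sub>R S x + (1/2) *\<^sub>R T x) = (1/2) *\<^sub>R ((X x - S x) + (X x - T x))" for x
    by (simp add: algebra_simps flip: scaleR_add_left)
  moreover have "(X x - S x) - (X x - T x) = T x - S x" for x by simp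
  ultimately show ?thesis
    using l2norm_parallelogram[OF square_integrable_diff[OF assms(1,2)] square_integrable_diff[OF assms(1,3)]]
    by (simp add: l2norm_minus_commute[of M T S])
qed

text \<open>The Hilbert space argument: midpoints stay in the convex set, so a minimizing sequence
  is Cauchy, and the set is closed. Completeness is obtained by hand from an almost everywhere limit
  and Fatou's lemma.\<close>

lemma (in prob_space) projection_exists:
  fixes X :: "'a \<Rightarrow> 'b::euclidean_space"
  assumes X: "square_integrable M X" and \<nu>: "\<nu> \<in> P2"
  obtains T where "is_projection M X \<nu> T"
proof -
  define C where "C = {T. dominated M T \<nu>}"
  define q where "q T = (l2norm M (\<lambda>x. X x - T x))\<^sup>2" for T
  define d where "d = (INF T\<in>C. q T)"
  have ne: "C \<noteq> {}" using dominated_const_mean[OF \<nu>] by (auto simp: C_def)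
  have bdd: "bdd_below (q ` C)" by (rule bdd_belowI[of _ 0]) (auto simp: q_def)
  have d_le: "d \<le> q T" if "T \<in> C" for T
    unfolding d_def using that by (intro cINF_lower bdd)
  have d0: "0 \<le> d" unfolding d_def using ne by (intro cINF_greatest) (auto simp: q_def)
  \<comment> \<open>The parallelogram bound for neighbours is at most
    \<open>2 * (1/16) * (1 + 1/4) * (1/4) ^ n\<close>, below \<open>(1/4) ^ n\<close>; increments
    are then at most \<open>(1/2) ^ n\<close>, which is summable.\<close>
  have "\<exists>T\<in>C. q T < d + (1/16) * (1/4) ^ n" for n
    unfolding d_def using ne by (subst cINF_less_iff[OF ne bdd, symmetric]) simp
  then obtain T where T: "\<And>n. T n \<in> C" and qT: "\<And>n. q (T n) < d + (1/16) * (1/4) ^ n" by metis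
  have dom: "dominated M (T n) \<nu>" for n using T by (simp add: C_def)
  note sq = dominated_square_integrable[OF dom]
  have close: "l2norm M (\<lambda>x. T (Suc n) x - T n x) \<le> (1/2) ^ n" for n
  proof (rule power2_le_imp_le)
    have "d \<le> q (\<lambda>x. (1/2) *\<^sub>R T (Suc n) x + (1/2) *\<^sub>R T n x)"
      by (rule d_le) (auto simp: C_def intro!: dominated_convex dom prob_space_axioms)
    then have "(l2norm M (\<lambda>x. T (Suc n) x - T n x))\<^sup>2 \<le> 2 * q (T (Suc n)) + 2 * q (T n) - 4 * d"
      unfolding q_def l2norm_midpoint[OF X sq sq] by simp
    also have "\<dots> \<le> (1/4) ^ n"
    proof -
      have "0 \<le> (1/4 :: real) ^ n" "(1/4 :: real) ^ Suc n = 1/4 * (1/4) ^ n" by simp_all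
      then show ?thesis using qT[of n] qT[of "Suc n"] by linarith
    qed
    also have "\<dots> = ((1/2) ^ n)\<^sup>2"
      by (simp add: power2_eq_square flip: power_mult_distrib)
    finally show "(l2norm M (\<lambda>x. T (Suc n) x - T n x))\<^sup>2 \<le> ((1/2) ^ n)\<^sup>2" .
  qed simp
  \<comment> \<open>The right-hand side is the geometric sum of \<open>(1/2) ^ (n + i)\<close> over
    \<open>i < k\<close>; keeping the exact sum makes the induction close.\<close>
  have far: "l2norm M (\<lambda>x. T (n + k) x - T n x) \<le> 2 * (1/2) ^ n * (1 - (1/2) ^ k)" for n k
  proof (induction k)
    case (Suc k)
    have "l2norm M (\<lambda>x. T (n + Suc k) x - T n x)
        \<le> l2norm M (\<lambda>x. T (Suc (n + k)) x - T (n + k) x) + l2norm M (\<lambda>x. T (n + k) x - T n x)"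
      using l2norm_triangle[OF sq sq sq] by simp
    also have "\<dots> \<le> (1/2) ^ (n + k) + 2 * (1/2) ^ n * (1 - (1/2) ^ k)"
      by (intro add_mono close Suc)
    also have "\<dots> = 2 * (1/2) ^ n * (1 - (1/2) ^ Suc k)"
      by (simp add: power_add algebra_simps)
    finally show ?case .
  qed (simp add: l2norm_def)
  obtain S where S [measurable]: "S \<in> borel_measurable M"
    and lim: "AE x in M. (\<lambda>n. T n x) \<longlonglongrightarrow> S x"
  proof (rule l2norm_Cauchy_AE_limit)
    show "(\<integral>x. norm (T (Suc n) x - T n x) \<partial>M) \<le> (1/2) ^ n" for n
      using expectation_norm_le_l2norm[OF square_integrable_diff[OF sq sq], of "Suc n" n] close[of n]
      by linarith
  qed (use sq in auto)
  \<comment> \<open>Fatou's lemma along \<open>k\<close> for \<open>T (n + k) - T n\<close> upgrades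
    pointwise convergence to convergence in \<open>l2norm\<close>.\<close>
  have S_sq: "square_integrable M (\<lambda>x. S x - T n x)"
    and S_le: "l2norm M (\<lambda>x. S x - T n x) \<le> 2 * (1/2) ^ n" for n
  proof -
    have *: "square_integrable M (\<lambda>x. T (n + k) x - T n x)" for k
      by (intro square_integrable_diff sq)
    have lim': "AE x in M. (\<lambda>k. T (n + k) x - T n x) \<longlonglongrightarrow> S x - T n x"
      using lim
    proof eventually_elim
      fix x assume "(\<lambda>n. T n x) \<longlonglongrightarrow> S x"
      from LIMSEQ_ignore_initial_segment[OF this, of n]
      show "(\<lambda>k. T (n + k) x - T n x) \<longlonglongrightarrow> S x - T n x"
        by (intro tendsto_intros) (simp add: add.commute)
    qed
    have meas: "(\<lambda>x. S x - T n x) \<in> borel_measurable M"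
      using square_integrable_measurable[OF sq[of n]] by measurable
    have "l2norm M (\<lambda>x. T (n + k) x - T n x) \<le> 2 * (1/2) ^ n" for k
      by (rule order_trans[OF far]) (simp add: mult_left_le)
    from square_integrable_Fatou[OF * meas lim' this tendsto_const]
    show "square_integrable M (\<lambda>x. S x - T n x)" "l2norm M (\<lambda>x. S x - T n x) \<le> 2 * (1/2) ^ n"
      by auto
  qed
  have S_sq: "square_integrable M S"
    using square_integrable_add[OF S_sq[of 0] sq[of 0]] by simp
  have "(\<lambda>n. 2 * (1/2) ^ n :: real) \<longlonglongrightarrow> 2 * 0"
    by (intro tendsto_intros LIMSEQ_power_zero) auto
  then have pow: "(\<lambda>n. 2 * (1/2) ^ n :: real) \<longlonglongrightarrow> 0" by simp
  have lim0: "(\<lambda>n. l2norm M (\<lambda>x. S x - T n x)) \<longlonglongrightarrow> 0"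
    by (rule tendsto_sandwich[OF _ _ tendsto_const pow]) (auto intro: always_eventually S_le)
  have S_dom: "dominated M S \<nu>" using dom S_sq lim0 by (rule dominated_closed)
  have "l2norm M (\<lambda>x. X x - S x) \<le> sqrt d"
  proof -
    have "l2norm M (\<lambda>x. X x - S x) \<le> sqrt (d + (1/16) * (1/4) ^ n) + 2 * (1/2) ^ n" for n
    proof -
      have "l2norm M (\<lambda>x. X x - T n x) = sqrt (q (T n))" by (simp add: q_def)
      also have "\<dots> \<le> sqrt (d + (1/16) * (1/4) ^ n)" using qT[of n] by simp
      finally show ?thesis
        using l2norm_triangle[OF X sq[of n] S_sq] S_le[of n] by (simp add: l2norm_minus_commute[of M S])
    qed
    moreover have "(\<lambda>n. sqrt (d + (1/16) * (1/4) ^ n) + 2 * (1/2) ^ n) \<longlonglongrightarrow> sqrt (d + (1/16) * 0) + 2 * 0"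
      by (intro tendsto_intros LIMSEQ_power_zero) auto
    ultimately show ?thesis by (intro LIMSEQ_le_const[where X="\<lambda>n. sqrt (d + (1/16) * (1/4) ^ n) + 2 * (1/2) ^ n"]) auto
  qed
  moreover have "sqrt d \<le> l2norm M (\<lambda>x. X x - R x)" if "dominated M R \<nu>" for R
    using d_le[of R] that by (intro real_le_lsqrt) (auto simp: C_def q_def)
  ultimately have "is_projection M X \<nu> S"
    using S_dom unfolding is_projection_def by (meson order_trans)
  then show ?thesis by (rule that)
qed

text \<open>First-order optimality: moving \<open>T\<close> by a fraction \<open>t\<close> towards
  \<open>S\<close> stays in the convex set and cannot reduce the distance to \<open>X\<close>;
  divide by \<open>t\<close> and let it tend to 0.\<close>

lemma (in prob_space) projection_variational:
  assumes X: "square_integrable M X" and proj: "is_projection M X \<nu> T" and S: "dominated M S \<nu>"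
  shows "(\<integral>x. (X x - T x) \<bullet> (S x - T x) \<partial>M) \<le> 0"
proof -
  have T: "dominated M T \<nu>" using proj by (simp add: is_projection_def)
  note sqT = dominated_square_integrable[OF T] and sqS = dominated_square_integrable[OF S]
  define I where "I = (\<integral>x. (X x - T x) \<bullet> (S x - T x) \<partial>M)"
  define D where "D = (l2norm M (\<lambda>x. S x - T x))\<^sup>2"
  have XT: "square_integrable M (\<lambda>x. X x - T x)" and ST: "square_integrable M (\<lambda>x. S x - T x)"
    by (intro square_integrable_diff X sqT sqS)+
  have "2 * I \<le> t * D" if t: "0 < t" "t < 1" for t
  proof -
    have eq: "X x - ((1 - t) *\<^sub>R T x + t *\<^sub>R S x) = (X x - T x) - t *\<^sub>R (S x - T x)" for x
      by (simp add: algebra_simps)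
    have "dominated M (\<lambda>x. (1 - t) *\<^sub>R T x + t *\<^sub>R S x) \<nu>"
      using t by (intro dominated_convex prob_space_axioms T S) auto
    then have "(l2norm M (\<lambda>x. X x - T x))\<^sup>2
        \<le> (l2norm M (\<lambda>x. X x - ((1 - t) *\<^sub>R T x + t *\<^sub>R S x)))\<^sup>2"
      using proj unfolding is_projection_def by (intro power_mono) auto
    also have "\<dots> = (l2norm M (\<lambda>x. X x - T x))\<^sup>2 - 2 * (t * I) + t\<^sup>2 * D"
      unfolding eq l2norm_diff_power2[OF XT square_integrable_scaleR[OF ST]]
      by (simp add: I_def D_def l2norm_scaleR power_mult_distrib)
    finally have "t * (2 * I) \<le> t * (t * D)" by (simp add: power2_eq_square algebra_simps)
    then show ?thesis using t by simp
  qed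
  then have "eventually (\<lambda>t. 2 * I \<le> t * D) (at_right 0)"
    unfolding eventually_at_right_field by (intro exI[of _ 1]) auto
  moreover have "((\<lambda>t. t * D) \<longlongrightarrow> 0 * D) (at_right 0)" by (intro tendsto_intros)
  ultimately have "2 * I \<le> 0 * D" by (intro tendsto_lowerbound) auto
  then show ?thesis by (simp add: I_def)
qed

section \<open>Transporting domination along a coupling\<close>

text \<open>A Markov kernel from the space to \<open>J\<close>: \<open>g j y\<close> is the share of
  the mass at \<open>y\<close> sent to \<open>j\<close>. Integrated against a measure it encodes a
  coupling of that measure with a law on \<open>J\<close>.\<close>

definition unity_partition :: "'i set \<Rightarrow> ('i \<Rightarrow> 'a::euclidean_space \<Rightarrow> real) \<Rightarrow> bool" where
  "unity_partition J g \<longleftrightarrow>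
     (\<forall>j\<in>J. g j \<in> borel_measurable borel \<and> (\<forall>y. 0 \<le> g j y)) \<and> (\<forall>y. (\<Sum>j\<in>J. g j y) = 1)"

lemma unity_partition_le_1:
  assumes "unity_partition J g" "j \<in> J" "finite J"
  shows "g j y \<le> 1"
  using member_le_sum[of j J "\<lambda>j. g j y"] assms by (auto simp: unity_partition_def)

lemma unity_partition_combination:
  assumes g: "unity_partition J g" and g': "unity_partition J g'" and t: "0 \<le> t" "t \<le> 1"
  shows "unity_partition J (\<lambda>j y. (1 - t) * g j y + t * g' j y)"
  using assms by (auto simp: unity_partition_def sum.distrib simp flip: sum_distrib_left
      intro!: borel_measurable_add borel_measurable_times)

text \<open>The last three bounds do not depend on \<open>g\<close>; they bound the set of
  attainable masses and moments.\<close>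

lemma unity_partition_integrable:
  assumes g: "unity_partition J g" and J: "finite J" "j \<in> J" and \<nu>: "\<nu> \<in> P2"
  shows "integrable \<nu> (g j)" "integrable \<nu> (\<lambda>y. g j y *\<^sub>R y)"
    "0 \<le> (\<integral>y. g j y \<partial>\<nu>)" "(\<integral>y. g j y \<partial>\<nu>) \<le> 1"
    "norm (\<integral>y. g j y *\<^sub>R y \<partial>\<nu>) \<le> (\<integral>y. norm y \<partial>\<nu>)"
proof -
  interpret prob_space \<nu> using \<nu> by (rule P2_prob_space)
  have id: "integrable \<nu> (\<lambda>y. y)"
    using P2_square_integrable[OF \<nu>] by (rule square_integrable_integrable)
  have [measurable]: "g j \<in> borel_measurable \<nu>"
    using g J P2_sets[OF \<nu>] by (auto simp: unity_partition_def cong: measurable_cong_sets)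
  have b: "0 \<le> g j y" "g j y \<le> 1" for y
    using g J unity_partition_le_1[OF g J(2,1)] by (auto simp: unity_partition_def)
  show int: "integrable \<nu> (g j)"
    using b by (intro integrable_const_bound[of _ 1]) auto
  show "0 \<le> (\<integral>y. g j y \<partial>\<nu>)" using b by simp
  show "(\<integral>y. g j y \<partial>\<nu>) \<le> 1"
    using integral_mono[OF int, of "\<lambda>_. 1"] b by (simp add: prob_space)
  have n: "norm (g j y *\<^sub>R y) \<le> norm y" for y using b[of y] by (simp add: mult_left_le_one_le)
  show int': "integrable \<nu> (\<lambda>y. g j y *\<^sub>R y)"
  proof (rule Bochner_Integration.integrable_bound[OF id])
    show "(\<lambda>y. g j y *\<^sub>R y) \<in> borel_measurable \<nu>"
      using borel_measurable_integrable[OF id] by measurable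
    show "AE y in \<nu>. norm (g j y *\<^sub>R y) \<le> norm y" using n by (intro AE_I2)
  qed
  show "norm (\<integral>y. g j y *\<^sub>R y \<partial>\<nu>) \<le> (\<integral>y. norm y \<partial>\<nu>)"
    using n by (intro order_trans[OF integral_norm_bound] integral_mono integrable_norm int' id)
qed

text \<open>Linear functionals on pairs (mass, first moment) are maximised by the partition that
  shares the mass at each point among the affine functions attaining the maximum.\<close>

lemma unity_partition_maximizer:
  fixes h :: "'i \<Rightarrow> 'a::euclidean_space"
  assumes J: "finite J" "J \<noteq> {}" and \<nu>: "\<nu> \<in> P2"
  obtains g where "unity_partition J g"
    "(\<Sum>j\<in>J. w j * (\<integral>y. g j y \<partial>\<nu>) + h j \<bullet> (\<integral>y. g j y *\<^sub>R y \<partial>\<nu>))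
      = (\<integral>y. max_affine ((\<lambda>j. (w j, h j)) ` J) y \<partial>\<nu>)"
proof -
  define F where "F = (\<lambda>j. (w j, h j)) ` J"
  have F: "finite F" "F \<noteq> {}" using J by (auto simp: F_def)
  define a where "a j y = (if w j + h j \<bullet> y = max_affine F y then 1 else 0 :: real)" for j y
  define g where "g j y = a j y / (\<Sum>i\<in>J. a i y)" for j y
  have [measurable]: "max_affine F \<in> borel_measurable borel" by (rule max_affine_measurable[OF F])
  have a_meas [measurable]: "a j \<in> borel_measurable borel" for j
    unfolding a_def[abs_def] by measurable
  have pos: "0 < (\<Sum>i\<in>J. a i y)" for y
  proof -
    obtain c k where "(c, k) \<in> F" "max_affine F y = c + k \<bullet> y"
      using max_affine_attained[OF F] by metis
    then obtain i where "i \<in> J" "a i y = 1" by (auto simp: F_def a_def)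
    then show ?thesis using J by (intro sum_pos2[of J i]) (auto simp: a_def)
  qed
  have g: "unity_partition J g"
    using pos unfolding unity_partition_def g_def
    by (auto simp: less_imp_le less_imp_neq[symmetric] a_def simp flip: sum_divide_distrib
        intro!: sum_nonneg divide_nonneg_nonneg borel_measurable_divide borel_measurable_sum a_meas)
  note int = unity_partition_integrable[OF g J(1) _ \<nu>]
  have "(\<Sum>j\<in>J. w j * (\<integral>y. g j y \<partial>\<nu>) + h j \<bullet> (\<integral>y. g j y *\<^sub>R y \<partial>\<nu>))
      = (\<Sum>j\<in>J. \<integral>y. w j * g j y + h j \<bullet> (g j y *\<^sub>R y) \<partial>\<nu>)"
  proof (rule sum.cong)
    fix j assume j: "j \<in> J"
    have "integrable \<nu> (\<lambda>y. w j * g j y)" using int(1)[OF j] by simp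
    moreover have "integrable \<nu> (\<lambda>y. h j \<bullet> (g j y *\<^sub>R y))"
      using int(2)[OF j] by (rule integrable_inner_right[rotated])
    ultimately show "w j * (\<integral>y. g j y \<partial>\<nu>) + h j \<bullet> (\<integral>y. g j y *\<^sub>R y \<partial>\<nu>)
        = (\<integral>y. w j * g j y + h j \<bullet> (g j y *\<^sub>R y) \<partial>\<nu>)"
      using integral_inner_right[OF int(2)[OF j], of "h j"]
      by (subst Bochner_Integration.integral_add) (simp_all del: inner_scaleR_right)
  qed simp
  also have "\<dots> = (\<integral>y. (\<Sum>j\<in>J. w j * g j y + h j \<bullet> (g j y *\<^sub>R y)) \<partial>\<nu>)"
    using int(1,2)
    by (intro Bochner_Integration.integral_sum[symmetric] Bochner_Integration.integrable_add
        integrable_inner_right) auto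
  also have "\<dots> = (\<integral>y. max_affine F y \<partial>\<nu>)"
  proof (rule Bochner_Integration.integral_cong)
    fix y
    have "(\<Sum>j\<in>J. w j * g j y + h j \<bullet> (g j y *\<^sub>R y)) = (\<Sum>j\<in>J. g j y * max_affine F y)"
    proof (intro sum.cong refl)
      fix j
      have "w j * g j y + h j \<bullet> (g j y *\<^sub>R y) = g j y * (w j + h j \<bullet> y)"
        by (simp add: algebra_simps)
      \<comment> \<open>Either piece \<open>j\<close> attains the maximum at \<open>y\<close> or the
        weight \<open>g j y\<close> is 0.\<close>
      also have "\<dots> = g j y * max_affine F y" by (simp add: g_def a_def)
      finally show "w j * g j y + h j \<bullet> (g j y *\<^sub>R y) = g j y * max_affine F y" .
    qed
    also have "\<dots> = max_affine F y"
      using g by (simp add: unity_partition_def flip: sum_distrib_right)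
    finally show "(\<Sum>j\<in>J. w j * g j y + h j \<bullet> (g j y *\<^sub>R y)) = max_affine F y" .
  qed simp
  finally show ?thesis using g that unfolding F_def by blast
qed

text \<open>This is where Strassen's theorem is replaced by an elementary argument: the squared distance from the prescribed masses and
  moments to the attainable ones has infimum 0, since from any attainable point a step of size
  \<^term>\<open>t\<close> towards the maximizer in the direction of the target multiplies it by
  \<^term>\<open>1 - 2 * t\<close>, up to a term of order \<^term>\<open>t\<^sup>2\<close>.\<close>

lemma unity_partition_approx_moments:
  fixes \<nu> :: "'a::euclidean_space measure" and p :: "'i \<Rightarrow> real" and t :: "'i \<Rightarrow> 'a"
  assumes J: "finite J" "J \<noteq> {}" and \<nu>: "\<nu> \<in> P2"
    and p: "\<And>j. j \<in> J \<Longrightarrow> 0 \<le> p j" "(\<Sum>j\<in>J. p j) = 1"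
    and le: "\<And>F. finite F \<Longrightarrow> F \<noteq> {} \<Longrightarrow> (\<Sum>j\<in>J. p j * max_affine F (t j)) \<le> (\<integral>y. max_affine F y \<partial>\<nu>)"
    and e: "0 < e"
  obtains g where "unity_partition J g"
    and "\<And>j. j \<in> J \<Longrightarrow> \<bar>p j - (\<integral>y. g j y \<partial>\<nu>)\<bar> \<le> e"
    and "\<And>j. j \<in> J \<Longrightarrow> norm (p j *\<^sub>R t j - (\<integral>y. g j y *\<^sub>R y \<partial>\<nu>)) \<le> e"
proof -
  define G :: "('i \<Rightarrow> 'a \<Rightarrow> real) set" where "G = {g. unity_partition J g}"
  define Q where "Q g j = (\<integral>y. g j y \<partial>\<nu>)" for g :: "'i \<Rightarrow> 'a \<Rightarrow> real" and j
  define U where "U g j = (\<integral>y. g j y *\<^sub>R y \<partial>\<nu>)" for g :: "'i \<Rightarrow> 'a \<Rightarrow> real" and j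
  define q where "q g = (\<Sum>j\<in>J. (p j - Q g j)\<^sup>2 + (norm (p j *\<^sub>R t j - U g j))\<^sup>2)" for g
  define d where "d = (INF g\<in>G. q g)"
  define m where "m = (\<integral>y. norm y \<partial>\<nu>)"
  \<comment> \<open>A bound for the squared diameter of the attainable set: two masses differ by at
    most 1, two first moments by at most \<open>2 * m\<close>.\<close>
  define D where "D = real (card J) * (1 + (2 * m)\<^sup>2)"
  have m0: "0 \<le> m" by (simp add: m_def)
  \<comment> \<open>The constant weights \<open>p j\<close> form a partition, corresponding to the
    independent coupling.\<close>
  have ne: "G \<noteq> {}" using p by (auto simp: G_def unity_partition_def intro!: exI[of _ "\<lambda>j y. p j"])
  have q0: "0 \<le> q g" for g by (auto simp: q_def intro!: sum_nonneg)
  have bdd: "bdd_below (q ` G)" by (rule bdd_belowI[of _ 0]) (auto simp: q0)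
  have d_le: "d \<le> q g" if "g \<in> G" for g
    unfolding d_def using that by (intro cINF_lower bdd)
  have step: "d \<le> (1 - 2 * s) * q g + s\<^sup>2 * D" if g: "g \<in> G" and s: "0 \<le> s" "s \<le> 1" for g s
  proof -
    \<comment> \<open>The pair \<open>(w, h)\<close> is the residual at \<open>g\<close>, the
      direction of steepest descent of \<open>q\<close>.\<close>
    define w where "w j = p j - Q g j" for j
    define h where "h j = p j *\<^sub>R t j - U g j" for j
    define F where "F = (\<lambda>j. (w j, h j)) ` J"
    have F: "finite F" "F \<noteq> {}" using J by (auto simp: F_def)
    obtain g' where g': "unity_partition J g'"
      and max: "(\<Sum>j\<in>J. w j * Q g' j + h j \<bullet> U g' j) = (\<integral>y. max_affine F y \<partial>\<nu>)"
      unfolding Q_def U_def F_def by (rule unity_partition_maximizer[OF J \<nu>, of w h])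
    have gp: "unity_partition J g" using g by (simp add: G_def)
    note int = unity_partition_integrable[OF gp J(1) _ \<nu>]
      and int' = unity_partition_integrable[OF g' J(1) _ \<nu>]
    define dQ where "dQ j = Q g' j - Q g j" for j
    define dU where "dU j = U g' j - U g j" for j
    \<comment> \<open>Hypothesis \<open>le\<close> for this \<open>F\<close> says that the target
      does not lie beyond the attainable set in direction \<open>(w, h)\<close>: the maximizer
      \<open>g'\<close> does at least as well there.\<close>
    have "(\<Sum>j\<in>J. w j * p j + h j \<bullet> (p j *\<^sub>R t j)) = (\<Sum>j\<in>J. p j * (w j + h j \<bullet> t j))"
      by (intro sum.cong) (auto simp: algebra_simps)
    also have "\<dots> \<le> (\<Sum>j\<in>J. p j * max_affine F (t j))"
      using F p by (intro sum_mono mult_left_mono max_affine_ge) (auto simp: F_def)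
    also have "\<dots> \<le> (\<Sum>j\<in>J. w j * Q g' j + h j \<bullet> U g' j)"
      unfolding max by (rule le[OF F])
    finally have "(\<Sum>j\<in>J. w j * p j + h j \<bullet> (p j *\<^sub>R t j)) - (\<Sum>j\<in>J. w j * Q g j + h j \<bullet> U g j)
        \<le> (\<Sum>j\<in>J. w j * Q g' j + h j \<bullet> U g' j) - (\<Sum>j\<in>J. w j * Q g j + h j \<bullet> U g j)"
      by simp
    then have "(\<Sum>j\<in>J. w j * (p j - Q g j) + h j \<bullet> (p j *\<^sub>R t j - U g j)) \<le> (\<Sum>j\<in>J. w j * dQ j + h j \<bullet> dU j)"
      unfolding sum_subtractf[symmetric] by (simp add: dQ_def dU_def algebra_simps inner_diff_right)
    moreover have "(\<Sum>j\<in>J. w j * (p j - Q g j) + h j \<bullet> (p j *\<^sub>R t j - U g j)) = q g"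
      unfolding q_def w_def h_def by (simp add: power2_eq_square power2_norm_eq_inner[unfolded power2_eq_square])
    ultimately have ascent: "q g \<le> (\<Sum>j\<in>J. w j * dQ j + h j \<bullet> dU j)" by simp
    have "(dQ j)\<^sup>2 + (norm (dU j))\<^sup>2 \<le> 1 + (2 * m)\<^sup>2" if j: "j \<in> J" for j
    proof (intro add_mono)
      have "\<bar>dQ j\<bar> \<le> 1" using int(3,4)[OF j] int'(3,4)[OF j] by (auto simp: dQ_def Q_def)
      then show "(dQ j)\<^sup>2 \<le> 1" by (simp add: abs_square_le_1)
      have "norm (dU j) \<le> 2 * m"
        using norm_triangle_ineq4[of "U g' j" "U g j"] int(5)[OF j] int'(5)[OF j]
        by (simp add: dU_def U_def m_def)
      then show "(norm (dU j))\<^sup>2 \<le> (2 * m)\<^sup>2" by (intro power_mono) auto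
    qed
    then have diam: "(\<Sum>j\<in>J. (dQ j)\<^sup>2 + (norm (dU j))\<^sup>2) \<le> D"
      unfolding D_def by (rule sum_bounded_above)
    define k where "k j y = (1 - s) * g j y + s * g' j y" for j y
    have "k \<in> G"
      unfolding G_def k_def using s by (auto intro: unity_partition_combination gp g')
    then have "d \<le> q k" by (rule d_le)
    also have "q k = (\<Sum>j\<in>J. (w j - s * dQ j)\<^sup>2 + (norm (h j - s *\<^sub>R dU j))\<^sup>2)"
      unfolding q_def
    proof (rule sum.cong)
      fix j assume j: "j \<in> J"
      have "Q k j = (1 - s) * Q g j + s * Q g' j"
        unfolding Q_def k_def using int(1)[OF j] int'(1)[OF j] by simp
      moreover have "U k j = (1 - s) *\<^sub>R U g j + s *\<^sub>R U g' j"
      proof -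
        have "U k j = (\<integral>y. (1 - s) *\<^sub>R (g j y *\<^sub>R y) + s *\<^sub>R (g' j y *\<^sub>R y) \<partial>\<nu>)"
          unfolding U_def k_def by (simp add: scaleR_add_left)
        also have "\<dots> = (1 - s) *\<^sub>R U g j + s *\<^sub>R U g' j"
          unfolding U_def using int(2)[OF j] int'(2)[OF j]
          by (subst Bochner_Integration.integral_add) (auto simp del: scaleR_scaleR)
        finally show ?thesis .
      qed
      ultimately have "p j - Q k j = w j - s * dQ j" "p j *\<^sub>R t j - U k j = h j - s *\<^sub>R dU j"
        by (auto simp: w_def h_def dQ_def dU_def algebra_simps)
      then show "(p j - Q k j)\<^sup>2 + (norm (p j *\<^sub>R t j - U k j))\<^sup>2
          = (w j - s * dQ j)\<^sup>2 + (norm (h j - s *\<^sub>R dU j))\<^sup>2" by simp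
    qed simp
    also have "\<dots> = (\<Sum>j\<in>J. ((w j)\<^sup>2 + (norm (h j))\<^sup>2) - 2 * s * (w j * dQ j + h j \<bullet> dU j)
        + s\<^sup>2 * ((dQ j)\<^sup>2 + (norm (dU j))\<^sup>2))"
      unfolding norm_diff_power2
      by (intro sum.cong) (auto simp: power2_diff power_mult_distrib algebra_simps)
    also have "\<dots> = q g - 2 * s * (\<Sum>j\<in>J. w j * dQ j + h j \<bullet> dU j)
        + s\<^sup>2 * (\<Sum>j\<in>J. (dQ j)\<^sup>2 + (norm (dU j))\<^sup>2)"
      unfolding q_def w_def[symmetric] h_def[symmetric]
      by (simp add: sum.distrib sum_subtractf sum_distrib_left distrib_left mult.assoc)
    also have "\<dots> \<le> q g - 2 * s * q g + s\<^sup>2 * D"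
      using s by (intro add_mono diff_mono mult_left_mono ascent diam) auto
    finally show ?thesis by (simp add: algebra_simps)
  qed
  \<comment> \<open>A partition within \<open>s^2\<close> of the infimum loses no more than the
    order of the quadratic term. The step of size \<open>s\<close> then bounds \<open>d\<close> by a
    multiple of \<open>s\<close>, so \<open>d\<close> is at most 0.\<close>
  have "2 * d \<le> s * (1 + D)" if s: "0 < s" "s < 1/2" for s
  proof -
    obtain g where g: "g \<in> G" "q g < d + s\<^sup>2"
      using cINF_less_iff[OF ne bdd, of "d + s\<^sup>2"] s by (auto simp: d_def)
    have "d \<le> (1 - 2 * s) * q g + s\<^sup>2 * D" using s by (intro step g) auto
    also have "\<dots> \<le> (1 - 2 * s) * (d + s\<^sup>2) + s\<^sup>2 * D"
      using s g by (intro add_mono mult_left_mono) auto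
    also have "\<dots> \<le> d - 2 * s * d + s\<^sup>2 + s\<^sup>2 * D"
      using s by (simp add: algebra_simps)
    finally have "s * (2 * d) \<le> s * (s * (1 + D))" by (simp add: power2_eq_square algebra_simps)
    then show ?thesis using s by simp
  qed
  then have "eventually (\<lambda>s. 2 * d \<le> s * (1 + D)) (at_right 0)"
    unfolding eventually_at_right_field by (intro exI[of _ "1/2"]) auto
  moreover have "((\<lambda>s. s * (1 + D)) \<longlongrightarrow> 0 * (1 + D)) (at_right 0)" by (intro tendsto_intros)
  ultimately have "2 * d \<le> 0 * (1 + D)" by (intro tendsto_lowerbound) auto
  then obtain g where g: "g \<in> G" and qg: "q g < e\<^sup>2"
    using cINF_less_iff[OF ne bdd, of "e\<^sup>2"] e
    by (metis d_def mult_zero_left mult_le_0_iff not_numeral_le_zero order_le_less_trans zero_less_power)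
  have sm: "(p j - Q g j)\<^sup>2 \<le> e\<^sup>2 \<and> (norm (p j *\<^sub>R t j - U g j))\<^sup>2 \<le> e\<^sup>2" if "j \<in> J" for j
  proof -
    have "(p j - Q g j)\<^sup>2 + (norm (p j *\<^sub>R t j - U g j))\<^sup>2 \<le> q g"
      unfolding q_def using that J by (intro member_le_sum) auto
    then show ?thesis
      using qg zero_le_power2[of "p j - Q g j"] zero_le_power2[of "norm (p j *\<^sub>R t j - U g j)"]
      by linarith
  qed
  show ?thesis
  proof (rule that[of g])
    show "unity_partition J g" using g by (simp add: G_def)
    fix j assume "j \<in> J"
    then show "\<bar>p j - (\<integral>y. g j y \<partial>\<nu>)\<bar> \<le> e" "norm (p j *\<^sub>R t j - (\<integral>y. g j y *\<^sub>R y \<partial>\<nu>)) \<le> e"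
      using sm[of j] e unfolding Q_def U_def
      by (auto intro: power2_le_imp_le simp flip: abs_le_square_iff)
  qed
qed

text \<open>Averaging with the weights \<open>g\<close> requires the prescribed masses exactly,
  while an error in the moments only shifts the averages slightly. Hence the mass error is removed
  at the expense of the moments.\<close>

lemma unity_partition_exact_mass:
  fixes \<nu> :: "'a::euclidean_space measure" and p :: "'i \<Rightarrow> real" and t :: "'i \<Rightarrow> 'a"
  assumes J: "finite J" "J \<noteq> {}" and \<nu>: "\<nu> \<in> P2"
    and p: "\<And>j. j \<in> J \<Longrightarrow> 0 < p j" "(\<Sum>j\<in>J. p j) = 1"
    and le: "\<And>F. finite F \<Longrightarrow> F \<noteq> {} \<Longrightarrow> (\<Sum>j\<in>J. p j * max_affine F (t j)) \<le> (\<integral>y. max_affine F y \<partial>\<nu>)"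
    and e: "0 < e"
  obtains g where "unity_partition J g"
    and "\<And>j. j \<in> J \<Longrightarrow> (\<integral>y. g j y \<partial>\<nu>) = p j"
    and "\<And>j. j \<in> J \<Longrightarrow> norm (p j *\<^sub>R t j - (\<integral>y. g j y *\<^sub>R y \<partial>\<nu>)) \<le> e"
proof -
  interpret prob_space \<nu> using \<nu> by (rule P2_prob_space)
  have id: "integrable \<nu> (\<lambda>y. y)"
    using P2_square_integrable[OF \<nu>] by (rule square_integrable_integrable)
  \<comment> \<open>Collects the three moment errors, each in units of \<open>\<eta>\<close>: the
    approximation error, the scaling by \<open>1 - \<eta>\<close>, and the added constants
    \<open>r j\<close>, which are at most \<open>2 * \<eta>\<close>.\<close>
  define K where "K = 1 + (\<Sum>j\<in>J. norm (p j *\<^sub>R t j)) + 2 * norm (mean \<nu>)"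
  have K: "0 < K" unfolding K_def by (intro add_pos_nonneg sum_nonneg) auto
  define \<eta> where "\<eta> = min (1/2) (e / K)"
  have \<eta>: "0 < \<eta>" "\<eta> \<le> 1/2" "\<eta> * K \<le> e"
    using e K by (auto simp: \<eta>_def min_def field_simps)
  \<comment> \<open>With \<open>\<delta> \<le> \<eta> * p j\<close> for every \<open>j\<close>, the
    bound \<open>(1 - \<eta>) * (1 + \<eta>) \<le> 1\<close> makes every correction
    \<open>r j\<close> nonnegative.\<close>
  define \<delta> where "\<delta> = \<eta> * Min (p ` J)"
  have Min: "0 < Min (p ` J)" using J p by auto
  have p1: "p j \<le> 1" if "j \<in> J" for j
    using member_le_sum[of j J p] p J that by (auto intro: less_imp_le)
  have \<delta>_le: "\<delta> \<le> \<eta> * p j" if "j \<in> J" for j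
    unfolding \<delta>_def using J that \<eta> by (intro mult_left_mono Min_le) auto
  have \<delta>: "0 < \<delta>" using \<eta> Min by (simp add: \<delta>_def)
  have \<delta>\<eta>: "\<delta> \<le> \<eta>"
  proof -
    obtain j where "j \<in> J" using J by auto
    then have "\<delta> \<le> \<eta> * p j" "\<eta> * p j \<le> \<eta> * 1" using \<delta>_le p1 \<eta> by (auto intro: mult_left_mono)
    then show ?thesis by simp
  qed
  obtain g where g: "unity_partition J g"
    and gQ: "\<And>j. j \<in> J \<Longrightarrow> \<bar>p j - (\<integral>y. g j y \<partial>\<nu>)\<bar> \<le> \<delta>"
    and gU: "\<And>j. j \<in> J \<Longrightarrow> norm (p j *\<^sub>R t j - (\<integral>y. g j y *\<^sub>R y \<partial>\<nu>)) \<le> \<delta>"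
    by (rule unity_partition_approx_moments[OF J \<nu> less_imp_le[OF p(1)] p(2) le \<delta>]) auto
  \<comment> \<open>Mixing with constants corrects the masses and moves the moments only by a multiple of \<^term>\<open>\<eta>\<close>.\<close>
  define r where "r j = p j - (1 - \<eta>) * (\<integral>y. g j y \<partial>\<nu>)" for j
  define g' where "g' j y = (1 - \<eta>) * g j y + r j" for j y
  note int = unity_partition_integrable[OF g J(1) _ \<nu>]
  have r: "0 \<le> r j" "r j \<le> \<eta> + \<delta>" if j: "j \<in> J" for j
  proof -
    have "(1 - \<eta>) * (\<integral>y. g j y \<partial>\<nu>) \<le> (1 - \<eta>) * (p j + \<delta>)"
      using gQ[OF j] \<eta> by (intro mult_left_mono) auto
    also have "\<dots> \<le> (1 - \<eta>) * (p j + \<eta> * p j)"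
      using \<delta>_le[OF j] \<eta> by (intro mult_left_mono) auto
    also have "\<dots> = p j - \<eta>\<^sup>2 * p j" by (simp add: algebra_simps power2_eq_square)
    also have "\<dots> \<le> p j"
      using mult_nonneg_nonneg[OF zero_le_power2[of \<eta>] less_imp_le[OF p(1)[OF j]]] by linarith
    finally show "0 \<le> r j" by (simp add: r_def)
    have "(1 - \<eta>) * (p j - \<delta>) \<le> (1 - \<eta>) * (\<integral>y. g j y \<partial>\<nu>)"
      using gQ[OF j] \<eta> by (intro mult_left_mono) auto
    moreover have "p j - (1 - \<eta>) * (p j - \<delta>) = \<eta> * p j + \<delta> - \<eta> * \<delta>" by (simp add: algebra_simps)
    moreover have "\<eta> * p j \<le> \<eta>" using p1[OF j] \<eta> by (simp add: mult_left_le)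
    moreover have "0 \<le> \<eta> * \<delta>" using \<eta> \<delta> by simp
    ultimately show "r j \<le> \<eta> + \<delta>" unfolding r_def by linarith
  qed
  have Q1: "(\<Sum>j\<in>J. \<integral>y. g j y \<partial>\<nu>) = 1"
    using g int(1) by (subst Bochner_Integration.integral_sum[symmetric])
      (auto simp: unity_partition_def prob_space)
  show ?thesis
  proof (rule that[of g'])
    have "(\<Sum>j\<in>J. r j) = \<eta>"
      unfolding r_def by (simp add: sum_subtractf p Q1 flip: sum_distrib_left)
    then show "unity_partition J g'"
      using g r(1) \<eta>
      by (auto simp: unity_partition_def g'_def[abs_def] sum.distrib simp flip: sum_distrib_left
          intro!: borel_measurable_add borel_measurable_times)
    fix j assume j: "j \<in> J"
    show "(\<integral>y. g' j y \<partial>\<nu>) = p j"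
      using int(1)[OF j] by (simp add: g'_def r_def prob_space)
    define u where "u = (\<integral>y. g j y *\<^sub>R y \<partial>\<nu>)"
    have "(\<integral>y. g' j y *\<^sub>R y \<partial>\<nu>) = (\<integral>y. (1 - \<eta>) *\<^sub>R (g j y *\<^sub>R y) + r j *\<^sub>R y \<partial>\<nu>)"
      by (simp add: g'_def scaleR_add_left)
    also have "\<dots> = (1 - \<eta>) *\<^sub>R u + r j *\<^sub>R mean \<nu>"
      using int(2)[OF j] id
      by (subst Bochner_Integration.integral_add) (auto simp: u_def mean_def simp del: scaleR_scaleR)
    finally have eq: "p j *\<^sub>R t j - (\<integral>y. g' j y *\<^sub>R y \<partial>\<nu>)
        = (1 - \<eta>) *\<^sub>R (p j *\<^sub>R t j - u) + \<eta> *\<^sub>R (p j *\<^sub>R t j) - r j *\<^sub>R mean \<nu>"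
      by (simp add: algebra_simps)
    have "norm (p j *\<^sub>R t j - (\<integral>y. g' j y *\<^sub>R y \<partial>\<nu>))
        \<le> (1 - \<eta>) * norm (p j *\<^sub>R t j - u) + \<eta> * norm (p j *\<^sub>R t j) + r j * norm (mean \<nu>)"
    proof -
      have "norm ((1 - \<eta>) *\<^sub>R (p j *\<^sub>R t j - u)) = (1 - \<eta>) * norm (p j *\<^sub>R t j - u)"
        "norm (\<eta> *\<^sub>R (p j *\<^sub>R t j)) = \<eta> * norm (p j *\<^sub>R t j)"
        "norm (r j *\<^sub>R mean \<nu>) = r j * norm (mean \<nu>)"
        using \<eta> r(1)[OF j] by (auto simp del: scaleR_scaleR)
      then show ?thesis
        unfolding eq
        by (intro order_trans[OF norm_triangle_ineq4] add_mono order_trans[OF norm_triangle_ineq]) auto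
    qed
    also have "\<dots> \<le> 1 * \<eta> + \<eta> * (\<Sum>j\<in>J. norm (p j *\<^sub>R t j)) + (2 * \<eta>) * norm (mean \<nu>)"
    proof (intro add_mono mult_mono)
      show "norm (p j *\<^sub>R t j - u) \<le> \<eta>" using gU[OF j] \<delta>\<eta> by (simp add: u_def)
      show "norm (p j *\<^sub>R t j) \<le> (\<Sum>j\<in>J. norm (p j *\<^sub>R t j))"
        using J j by (intro member_le_sum) auto
      show "r j \<le> 2 * \<eta>" using r(2)[OF j] \<delta>\<eta> by simp
    qed (use \<eta> in auto)
    also have "\<dots> = \<eta> * K" by (simp add: K_def algebra_simps)
    also have "\<dots> \<le> e" by (rule \<eta>)
    finally show "norm (p j *\<^sub>R t j - (\<integral>y. g' j y *\<^sub>R y \<partial>\<nu>)) \<le> e" .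
  qed
qed

section \<open>Transport of a dominated map by averaging a coupling\<close>

lemma couplingsD:
  assumes "\<pi> \<in> couplings \<mu> \<nu>" "\<mu> \<in> P2" "\<nu> \<in> P2"
  shows "prob_space \<pi>" "sets \<pi> = sets (borel \<Otimes>\<^sub>M borel)"
    "fst \<in> measurable \<pi> borel" "snd \<in> measurable \<pi> borel"
    "distr \<pi> borel fst = \<mu>" "distr \<pi> borel snd = \<nu>"
    "square_integrable \<pi> fst" "square_integrable \<pi> snd" "dominated \<pi> snd \<nu>"
proof -
  show s: "sets \<pi> = sets (borel \<Otimes>\<^sub>M borel)" and fst: "distr \<pi> borel fst = \<mu>" and snd: "distr \<pi> borel snd = \<nu>"
    using assms by (auto simp: couplings_def)
  show mfst [measurable]: "fst \<in> measurable \<pi> borel" and msnd [measurable]: "snd \<in> measurable \<pi> borel"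
    by (auto cong: measurable_cong_sets[OF s refl])
  show pr: "prob_space \<pi>"
    using fst mfst P2_prob_space[OF assms(2)] prob_space_distrD by blast
  show "square_integrable \<pi> fst" "square_integrable \<pi> snd"
    using square_integrable_distr[OF mfst, of "\<lambda>x. x"] square_integrable_distr[OF msnd, of "\<lambda>x. x"]
      P2_square_integrable[OF assms(2)] P2_square_integrable[OF assms(3)]
    by (auto simp: fst snd)
  have "dominated \<nu> (\<lambda>x. x) \<nu>" using P2_square_integrable[OF assms(3)] by (simp add: dominated_def)
  then show "dominated \<pi> snd \<nu>"
    using dominated_distr[OF msnd, of "\<lambda>x. x" \<nu>] by (simp add: snd)
qed

lemma (in prob_space) l2norm_le_const:
  assumes "square_integrable M Z" "AE x in M. norm (Z x) \<le> e" "0 \<le> e"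
  shows "l2norm M Z \<le> e"
proof (rule power2_le_imp_le)
  have "(\<integral>x. (norm (Z x))\<^sup>2 \<partial>M) \<le> (\<integral>x. e\<^sup>2 \<partial>M)"
    using assms(2) by (intro integral_mono_AE square_integrableD assms(1))
      (auto elim!: eventually_mono intro: power_mono)
  then show "(l2norm M Z)\<^sup>2 \<le> e\<^sup>2" by (simp add: l2norm_power2 prob_space)
qed (rule assms)

text \<open>After averaging, \<open>T\<close> takes finitely many values and is nearly the average
  of the first coordinate of \<open>\<pi>\<close> under suitable weights. The same weights applied
  to the second coordinate give \<open>S\<close>, and averaging contracts the distance of the two
  coordinates.\<close>

lemma dominated_transport:
  fixes T :: "'c \<Rightarrow> 'a::euclidean_space"
  assumes N: "prob_space N" and T: "dominated N T \<nu>'" and \<nu>: "\<nu> \<in> P2" "\<nu>' \<in> P2"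
    and \<pi>: "\<pi> \<in> couplings \<nu>' \<nu>" and e: "0 < e"
  obtains S where "dominated N S \<nu>"
    "l2norm N (\<lambda>x. S x - T x) \<le> l2norm \<pi> (\<lambda>z. fst z - snd z) + e"
proof -
  interpret N: prob_space N by fact
  note [measurable] = couplingsD(3,4)[OF \<pi> \<nu>(2,1)]
  note sqT = dominated_square_integrable[OF T]
  \<comment> \<open>Averaging doubles the error \<open>e / 4\<close>; the remaining
    \<open>e / 2\<close> is reserved for the inexact moments.\<close>
  obtain R where R: "simple_function N R" "square_integrable N R"
    and RT: "l2norm N (\<lambda>x. T x - R x) < e / 4"
    using square_integrable_simple_approx[OF sqT, of "e / 4"] e by auto
  define J where "J = {r \<in> R ` space N. 0 < measure N {x \<in> space N. R x = r}}"
  have idN: "distr N N (\<lambda>x. x) = N" by (rule distr_id)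
  interpret A: averaging N N J R "\<lambda>r x. indicat_real {r} (R x)"
    unfolding J_def using averaging_pullback[OF N _ idN R(1)] by simp
  have AT: "l2norm N (\<lambda>x. T x - A.avg T x) \<le> e / 2"
    using averaging_pullback_close[OF N _ idN R sqT] RT by simp
  define p where "p j = measure N {x \<in> space N. R x = j}" for j
  have mass: "A.mass j = p j" for j by (simp add: A.mass_def p_def)
  have p: "\<And>j. j \<in> J \<Longrightarrow> 0 < p j" "(\<Sum>j\<in>J. p j) = 1"
    using A.mass_gt_0 A.sum_mass by (auto simp: mass)
  have J: "finite J" "J \<noteq> {}" using A.finite_J p(2) by auto
  define t where "t j = A.cell_avg T j" for j
  \<comment> \<open>The averaged \<open>T\<close> has a finitely supported law with values
    \<open>t j\<close> and masses \<open>p j\<close>, still dominated by \<open>\<nu>'\<close>: this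
    is the input of the discrete Strassen argument.\<close>
  have le: "(\<Sum>j\<in>J. p j * max_affine F (t j)) \<le> (\<integral>y. max_affine F y \<partial>\<nu>')" if F: "finite F" "F \<noteq> {}" for F
  proof -
    have "(\<Sum>j\<in>J. p j * max_affine F (t j)) = (\<integral>x. max_affine F (A.avg T x) \<partial>N)"
      using A.integral_\<kappa>[of "\<lambda>j. max_affine F (t j)"] by (simp add: mass A.avg_def t_def)
    also have "\<dots> \<le> (\<integral>y. max_affine F y \<partial>\<nu>')"
      using A.avg_dominated[OF T] F by (rule dominatedD)
    finally show ?thesis .
  qed
  have Min: "0 < Min (p ` J)" using J p by auto
  obtain g where g: "unity_partition J g"
    and gQ: "\<And>j. j \<in> J \<Longrightarrow> (\<integral>y. g j y \<partial>\<nu>') = p j"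
    and gU: "\<And>j. j \<in> J \<Longrightarrow> norm (p j *\<^sub>R t j - (\<integral>y. g j y *\<^sub>R y \<partial>\<nu>')) \<le> e / 2 * Min (p ` J)"
    by (rule unity_partition_exact_mass[OF J \<nu>(2) p le, of "e / 2 * Min (p ` J)"]) (use e Min in auto)
  have g_meas [measurable]: "g j \<in> borel_measurable borel" if "j \<in> J" for j
    using g that by (simp add: unity_partition_def)
  interpret pi: prob_space \<pi> by (rule couplingsD(1)[OF \<pi> \<nu>(2,1)])
  \<comment> \<open>The weights see only the first coordinate of \<open>\<pi>\<close>, but average
    both coordinates.\<close>
  interpret B: averaging \<pi> N J R "\<lambda>j z. g j (fst z)"
  proof
    fix j assume j: "j \<in> J"
    show "(\<integral>z. g j (fst z) \<partial>\<pi>) = measure N {x \<in> space N. R x = j}"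
      using gQ[OF j] integral_distr[OF couplingsD(3)[OF \<pi> \<nu>(2,1)] g_meas[OF j]]
      by (simp add: couplingsD(5)[OF \<pi> \<nu>(2,1)] p_def)
    show "(\<lambda>z. g j (fst z)) \<in> borel_measurable \<pi>" using g_meas[OF j] by measurable
    show "0 \<le> g j (fst y)" for y using g j by (simp add: unity_partition_def)
  qed (use g J A.\<kappa>_in_J A.mass_pos in \<open>auto simp: unity_partition_def\<close>)
  have massB: "B.mass j = p j" for j by (simp add: B.mass_def p_def)
  have sq: "square_integrable \<pi> fst" "square_integrable \<pi> snd" by (rule couplingsD[OF \<pi> \<nu>(2,1)])+
  have "AE x in N. norm (B.avg fst x - A.avg T x) \<le> e / 2"
    using A.\<kappa>_in_J
  proof eventually_elim
    fix x assume x: "R x \<in> J"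
    let ?j = "R x"
    have "(\<integral>z. g ?j (fst z) *\<^sub>R fst z \<partial>\<pi>) = (\<integral>y. g ?j y *\<^sub>R y \<partial>\<nu>')"
      using integral_distr[OF couplingsD(3)[OF \<pi> \<nu>(2,1)], of "\<lambda>y. g ?j y *\<^sub>R y"] g_meas[OF x]
      by (simp add: couplingsD(5)[OF \<pi> \<nu>(2,1)])
    then have "B.avg fst x - A.avg T x = - (1 / p ?j) *\<^sub>R (p ?j *\<^sub>R t ?j - (\<integral>y. g ?j y *\<^sub>R y \<partial>\<nu>'))"
      using p(1)[OF x]
      by (simp add: B.avg_def B.cell_avg_def massB A.avg_def t_def algebra_simps)
    then have "norm (B.avg fst x - A.avg T x) = norm (p ?j *\<^sub>R t ?j - (\<integral>y. g ?j y *\<^sub>R y \<partial>\<nu>')) / p ?j"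
      using p(1)[OF x] by (simp only: norm_scaleR) simp
    also have "\<dots> \<le> (e / 2 * Min (p ` J)) / p ?j"
      using p(1)[OF x] gU[OF x] by (intro divide_right_mono) auto
    also have "\<dots> \<le> e / 2"
      using p(1)[OF x] x J e Min_le[of "p ` J" "p ?j"] by (simp add: field_simps)
    finally show "norm (B.avg fst x - A.avg T x) \<le> e / 2" .
  qed
  then have BA: "l2norm N (\<lambda>x. B.avg fst x - A.avg T x) \<le> e / 2"
    using e by (intro N.l2norm_le_const square_integrable_diff B.avg_square_integrable
        A.avg_square_integrable) auto
  have BB: "l2norm N (\<lambda>x. B.avg snd x - B.avg fst x) \<le> l2norm \<pi> (\<lambda>z. fst z - snd z)"
    using B.avg_l2norm_diff_le[OF sq(2,1)] by (simp add: l2norm_minus_commute[of \<pi> snd])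
  show ?thesis
  proof (rule that)
    show "dominated N (B.avg snd) \<nu>"
      by (intro B.avg_dominated couplingsD(9)[OF \<pi> \<nu>(2,1)])
    show "l2norm N (\<lambda>x. B.avg snd x - T x) \<le> l2norm \<pi> (\<lambda>z. fst z - snd z) + e"
      using l2norm_triangle[OF B.avg_square_integrable[of snd] B.avg_square_integrable[of fst] sqT]
        l2norm_triangle[OF B.avg_square_integrable[of fst] A.avg_square_integrable[of T] sqT]
        BB BA AT l2norm_minus_commute[of N T "A.avg T"] by simp
  qed
qed

section \<open>Couplings and the Wasserstein distance\<close>

lemma couplings_distr:
  fixes X Z :: "'b \<Rightarrow> 'a::euclidean_space"
  assumes [measurable]: "X \<in> borel_measurable M" "Z \<in> borel_measurable M"
  shows "distr M (borel \<Otimes>\<^sub>M borel) (\<lambda>x. (X x, Z x)) \<in> couplings (distr M borel X) (distr M borel Z)"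
  by (simp add: couplings_def distr_distr comp_def)

text \<open>The product measure is a coupling.\<close>

lemma couplings_nonempty:
  fixes \<mu> \<nu> :: "'a::euclidean_space measure"
  assumes "\<mu> \<in> P2" "\<nu> \<in> P2"
  shows "couplings \<mu> \<nu> \<noteq> {}"
proof -
  interpret m: prob_space \<mu> using assms(1) by (rule P2_prob_space)
  interpret n: prob_space \<nu> using assms(2) by (rule P2_prob_space)
  note sets = P2_sets[OF assms(1)] P2_sets[OF assms(2)]
  note [measurable_cong] = sets
  have space: "space \<mu> = UNIV" "space \<nu> = UNIV" using sets[THEN sets_eq_imp_space_eq] by auto
  have "distr (\<mu> \<Otimes>\<^sub>M \<nu>) borel fst = \<mu>"
  proof (rule measure_eqI)
    fix A assume "A \<in> sets (distr (\<mu> \<Otimes>\<^sub>M \<nu>) borel fst)"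
    then have A: "A \<in> sets \<mu>" by (simp add: sets)
    then have "fst -` A \<inter> space (\<mu> \<Otimes>\<^sub>M \<nu>) = A \<times> space \<nu>"
      using sets.sets_into_space[OF A] by (auto simp: space_pair_measure)
    then show "emeasure (distr (\<mu> \<Otimes>\<^sub>M \<nu>) borel fst) A = emeasure \<mu> A"
      using A by (subst emeasure_distr) (simp_all add: n.emeasure_pair_measure_Times[OF A sets.top] n.emeasure_space_1, simp add: sets)
  qed (simp add: sets)
  moreover have "distr (\<mu> \<Otimes>\<^sub>M \<nu>) borel snd = \<nu>"
  proof (rule measure_eqI)
    fix A assume "A \<in> sets (distr (\<mu> \<Otimes>\<^sub>M \<nu>) borel snd)"
    then have A: "A \<in> sets \<nu>" by (simp add: sets)
    then have "snd -` A \<inter> space (\<mu> \<Otimes>\<^sub>M \<nu>) = space \<mu> \<times> A"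
      using sets.sets_into_space[OF A] by (auto simp: space_pair_measure)
    then show "emeasure (distr (\<mu> \<Otimes>\<^sub>M \<nu>) borel snd) A = emeasure \<nu> A"
      using A by (subst emeasure_distr) (simp_all add: n.emeasure_pair_measure_Times[OF sets.top A] m.emeasure_space_1, simp add: sets)
  qed (simp add: sets)
  moreover have "sets (\<mu> \<Otimes>\<^sub>M \<nu>) = sets (borel \<Otimes>\<^sub>M borel)"
    by (intro sets_pair_measure_cong sets)
  ultimately show ?thesis by (auto simp: couplings_def)
qed

lemma W2_eq_INF:
  "W2 \<mu> \<nu> = sqrt (INF \<pi>\<in>couplings \<mu> \<nu>. (l2norm \<pi> (\<lambda>z. fst z - snd z))\<^sup>2)"
  by (simp add: W2_def l2norm_power2)

lemma W2_le_l2norm: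
  assumes "\<pi> \<in> couplings \<mu> \<nu>"
  shows "W2 \<mu> \<nu> \<le> l2norm \<pi> (\<lambda>z. fst z - snd z)"
proof -
  have "(INF \<pi>\<in>couplings \<mu> \<nu>. (l2norm \<pi> (\<lambda>z. fst z - snd z))\<^sup>2) \<le> (l2norm \<pi> (\<lambda>z. fst z - snd z))\<^sup>2"
    using assms by (intro cINF_lower bdd_belowI[of _ 0]) auto
  then show ?thesis unfolding W2_eq_INF by (simp add: real_le_lsqrt)
qed

text \<open>Real \<open>sqrt\<close> is negative at negative arguments, so the sign has to come from
  the infimum, taken over a nonempty set of squares.\<close>

lemma W2_nonneg:
  assumes "\<mu> \<in> P2" "\<nu> \<in> P2"
  shows "0 \<le> W2 \<mu> \<nu>"
  unfolding W2_eq_INF using couplings_nonempty[OF assms]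
  by (intro real_sqrt_ge_zero cINF_greatest) auto

text \<open>Stands in for the existence of optimal couplings throughout.\<close>

lemma W2_almost_attained:
  assumes "\<mu> \<in> P2" "\<nu> \<in> P2" "0 < e"
  obtains \<pi> where "\<pi> \<in> couplings \<mu> \<nu>" "l2norm \<pi> (\<lambda>z. fst z - snd z) < W2 \<mu> \<nu> + e"
proof -
  let ?I = "INF \<pi>\<in>couplings \<mu> \<nu>. (l2norm \<pi> (\<lambda>z. fst z - snd z))\<^sup>2"
  note ne = couplings_nonempty[OF assms(1,2)]
  have bdd: "bdd_below ((\<lambda>\<pi>. (l2norm \<pi> (\<lambda>z. fst z - snd z))\<^sup>2) ` couplings \<mu> \<nu>)"
    by (intro bdd_belowI[of _ 0]) auto
  have "0 \<le> ?I" using ne by (intro cINF_greatest) auto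
  then have "?I = (W2 \<mu> \<nu>)\<^sup>2" by (simp add: W2_eq_INF)
  also have "\<dots> < (W2 \<mu> \<nu> + e)\<^sup>2"
    using W2_nonneg[OF assms(1,2)] assms(3) by (intro power_strict_mono) auto
  finally obtain \<pi> where \<pi>: "\<pi> \<in> couplings \<mu> \<nu>"
    "(l2norm \<pi> (\<lambda>z. fst z - snd z))\<^sup>2 < (W2 \<mu> \<nu> + e)\<^sup>2"
    using cINF_less_iff[OF ne bdd] by blast
  then have "l2norm \<pi> (\<lambda>z. fst z - snd z) < W2 \<mu> \<nu> + e"
    using W2_nonneg[OF assms(1,2)] assms(3) by (intro power2_less_imp_less[OF \<pi>(2)]) auto
  with \<pi>(1) show ?thesis by (rule that)
qed

lemma W2_distr_le:
  fixes X Z :: "'b \<Rightarrow> 'a::euclidean_space"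
  assumes [measurable]: "X \<in> borel_measurable M" "Z \<in> borel_measurable M"
  shows "W2 (distr M borel X) (distr M borel Z) \<le> l2norm M (\<lambda>x. X x - Z x)"
proof -
  have "W2 (distr M borel X) (distr M borel Z)
      \<le> l2norm (distr M (borel \<Otimes>\<^sub>M borel) (\<lambda>x. (X x, Z x))) (\<lambda>z. fst z - snd z)"
    by (intro W2_le_l2norm couplings_distr assms)
  also have "\<dots> = l2norm M (\<lambda>x. X x - Z x)"
    by (subst l2norm_distr) simp_all
  finally show ?thesis .
qed

lemma W2_commute_le:
  assumes "\<mu> \<in> P2" "\<nu> \<in> P2"
  shows "W2 \<nu> \<mu> \<le> W2 \<mu> \<nu>"
proof (rule field_le_epsilon)
  fix e :: real assume "0 < e"
  then obtain \<pi> where \<pi>: "\<pi> \<in> couplings \<mu> \<nu>" "l2norm \<pi> (\<lambda>z. fst z - snd z) < W2 \<mu> \<nu> + e"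
    using W2_almost_attained[OF assms] by metis
  have "W2 \<nu> \<mu> \<le> l2norm \<pi> (\<lambda>z. snd z - fst z)"
    using W2_distr_le[OF couplingsD(4,3)[OF \<pi>(1) assms]] couplingsD(5,6)[OF \<pi>(1) assms] by simp
  with \<pi>(2) show "W2 \<nu> \<mu> \<le> W2 \<mu> \<nu> + e" by (simp add: l2norm_minus_commute[of \<pi> snd])
qed

lemma centered_W2_commute: "\<mu> \<in> P2 \<Longrightarrow> \<nu> \<in> P2 \<Longrightarrow> centered_W2 \<mu> \<nu> = centered_W2 \<nu> \<mu>"
  using W2_commute_le[of \<mu> \<nu>] W2_commute_le[of \<nu> \<mu>] by (simp add: centered_W2_def norm_minus_commute)

text \<open>The mean of the difference under a nearly optimal coupling is at most its
  \<open>l2norm\<close>. This makes the radicand in \<open>centered_W2\<close> nonnegative.\<close>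

lemma norm_mean_diff_le_W2:
  assumes "\<mu> \<in> P2" "\<nu> \<in> P2"
  shows "norm (mean \<mu> - mean \<nu>) \<le> W2 \<mu> \<nu>"
proof (rule field_le_epsilon)
  fix e :: real assume "0 < e"
  then obtain \<pi> where \<pi>: "\<pi> \<in> couplings \<mu> \<nu>" "l2norm \<pi> (\<lambda>z. fst z - snd z) < W2 \<mu> \<nu> + e"
    using W2_almost_attained[OF assms] by metis
  note D = couplingsD[OF \<pi>(1) assms]
  interpret prob_space \<pi> by (rule D(1))
  have "mean \<mu> = expectation fst" "mean \<nu> = expectation snd"
    using integral_distr[OF D(3), of "\<lambda>x. x"] integral_distr[OF D(4), of "\<lambda>x. x"] D(5,6)
    by (auto simp: mean_def)
  then have "mean \<mu> - mean \<nu> = expectation (\<lambda>z. fst z - snd z)"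
    using D(7,8)[THEN square_integrable_integrable] by simp
  then show "norm (mean \<mu> - mean \<nu>) \<le> W2 \<mu> \<nu> + e"
    using norm_expectation_le_l2norm[OF square_integrable_diff[OF D(7,8)]] \<pi>(2) by simp
qed

lemma centered_W2_power2:
  assumes "\<mu> \<in> P2" "\<nu> \<in> P2"
  shows "(centered_W2 \<mu> \<nu>)\<^sup>2 = (W2 \<mu> \<nu>)\<^sup>2 - (norm (mean \<mu> - mean \<nu>))\<^sup>2"
  using power_mono[OF norm_mean_diff_le_W2[OF assms], of 2] by (simp add: centered_W2_def)

text \<open>Couplings of arbitrarily small cost force equal integrals of bounded Lipschitz
  functions. These approximate indicators of closed sets, an intersection-stable generator of the
  Borel sets.\<close>

lemma W2_eq_0_imp_eq:
  fixes \<mu> \<nu> :: "'a::euclidean_space measure"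
  assumes P2: "\<mu> \<in> P2" "\<nu> \<in> P2" and W2: "W2 \<mu> \<nu> = 0"
  shows "\<mu> = \<nu>"
proof -
  interpret m: prob_space \<mu> using P2(1) by (rule P2_prob_space)
  interpret n: prob_space \<nu> using P2(2) by (rule P2_prob_space)
  note sets = P2_sets[OF P2(1)] P2_sets[OF P2(2)]
  note [measurable_cong] = sets
  have space: "space \<mu> = UNIV" "space \<nu> = UNIV" using sets[THEN sets_eq_imp_space_eq] by auto
  have lip: "(\<integral>x. f x \<partial>\<mu>) = (\<integral>x. f x \<partial>\<nu>)"
    if L: "\<And>x y. \<bar>f x - f y\<bar> \<le> L * norm (x - y)" and b: "\<And>x. \<bar>f x\<bar> \<le> 1"
      and [measurable]: "f \<in> borel_measurable borel" for f :: "'a \<Rightarrow> real" and L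
  proof -
    have "\<bar>L\<bar> * norm (x - y) \<ge> L * norm (x - y)" for x y :: 'a by (intro mult_right_mono) auto
    then have L': "\<bar>f x - f y\<bar> \<le> \<bar>L\<bar> * norm (x - y)" for x y using L order_trans by blast
    have "\<bar>(\<integral>x. f x \<partial>\<mu>) - (\<integral>x. f x \<partial>\<nu>)\<bar> \<le> \<bar>L\<bar> * e" if e: "0 < e" for e
    proof -
      obtain \<pi> where \<pi>: "\<pi> \<in> couplings \<mu> \<nu>" "l2norm \<pi> (\<lambda>z. fst z - snd z) < W2 \<mu> \<nu> + e"
        using W2_almost_attained[OF P2 e] .
      note D = couplingsD[OF \<pi>(1) P2]
      note [measurable] = D(3,4)
      interpret prob_space \<pi> by (rule D(1))
      have int: "integrable \<pi> (\<lambda>z. f (fst z))" "integrable \<pi> (\<lambda>z. f (snd z))"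
        using b by (auto intro!: integrable_const_bound[of _ 1])
      have sq: "square_integrable \<pi> (\<lambda>z. fst z - snd z)" by (intro square_integrable_diff D)
      have "(\<integral>x. f x \<partial>\<mu>) - (\<integral>x. f x \<partial>\<nu>) = expectation (\<lambda>z. f (fst z) - f (snd z))"
        using integral_distr[OF D(3), of f] integral_distr[OF D(4), of f] int by (simp add: D(5,6))
      also have "\<bar>\<dots>\<bar> \<le> expectation (\<lambda>z. \<bar>f (fst z) - f (snd z)\<bar>)"
        by (rule integral_abs_bound)
      also have "\<dots> \<le> expectation (\<lambda>z. \<bar>L\<bar> * norm (fst z - snd z))"
        using int square_integrable_integrable[OF sq] L'
        by (intro integral_mono) (auto intro!: integrable_abs integrable_norm)
      also have "\<dots> = \<bar>L\<bar> * expectation (\<lambda>z. norm (fst z - snd z))" by simp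
      also have "\<dots> \<le> \<bar>L\<bar> * e"
        using expectation_norm_le_l2norm[OF sq] \<pi>(2) W2 by (intro mult_left_mono) auto
      finally show ?thesis .
    qed
    then have "eventually (\<lambda>e. \<bar>(\<integral>x. f x \<partial>\<mu>) - (\<integral>x. f x \<partial>\<nu>)\<bar> \<le> \<bar>L\<bar> * e) (at_right 0)"
      by (auto simp: eventually_at_filter)
    moreover have "((\<lambda>e. \<bar>L\<bar> * e) \<longlongrightarrow> \<bar>L\<bar> * 0) (at_right 0)" by (intro tendsto_intros)
    ultimately have "\<bar>(\<integral>x. f x \<partial>\<mu>) - (\<integral>x. f x \<partial>\<nu>)\<bar> \<le> \<bar>L\<bar> * 0"
      by (intro tendsto_lowerbound) auto
    then show ?thesis by simp
  qed
  have closed_eq: "emeasure \<mu> C = emeasure \<nu> C" if C: "closed C" for C :: "'a set"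
  \<comment> \<open>The empty set is separate because \<open>infdist\<close> to it is 0 by
    convention.\<close>
  proof (cases "C = {}")
    case False
    \<comment> \<open>Equal to 1 on \<open>C\<close>, Lipschitz with constant \<open>n\<close>, and
      eventually 0 at each point outside the closed set.\<close>
    define f where "f n x = max 0 (1 - real n * infdist x C)" for n x
    have meas [measurable]: "f n \<in> borel_measurable borel" for n
      unfolding f_def[abs_def]
      by (intro borel_measurable_continuous_onI continuous_intros)
    have b: "\<bar>f n x\<bar> \<le> 1" for n x using infdist_nonneg[of x C] by (auto simp: f_def)
    have "\<bar>f n x - f n y\<bar> \<le> real n * norm (x - y)" for n x y
    proof -
      have "\<bar>infdist x C - infdist y C\<bar> \<le> norm (x - y)"
        using infdist_triangle_abs[of x C y] by (simp add: dist_norm)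
      then have "real n * \<bar>infdist x C - infdist y C\<bar> \<le> real n * norm (x - y)"
        by (intro mult_left_mono) auto
      moreover have "real n * \<bar>infdist x C - infdist y C\<bar> = \<bar>real n * infdist x C - real n * infdist y C\<bar>"
        by (simp add: abs_mult flip: right_diff_distrib)
      ultimately show ?thesis unfolding f_def by linarith
    qed
    then have eq: "(\<integral>x. f n x \<partial>\<mu>) = (\<integral>x. f n x \<partial>\<nu>)" for n
      using b meas by (rule lip)
    have C_sets: "C \<in> sets borel" using C by auto
    have lim: "(\<lambda>n. f n x) \<longlonglongrightarrow> indicat_real C x" for x
    proof (cases "x \<in> C")
      case True
      then show ?thesis by (simp add: f_def)
    next
      case out: False
      then have "0 < infdist x C"
        using infdist_pos_not_in_closed[OF C False] by auto
      then obtain k where k: "1 < real k * infdist x C"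
        using reals_Archimedean3 by metis
      have "f n x = 0" if "k \<le> n" for n
      proof -
        have "real k * infdist x C \<le> real n * infdist x C"
          using that by (intro mult_right_mono) (auto simp: infdist_nonneg)
        then show ?thesis using k by (simp add: f_def)
      qed
      then show ?thesis
        using out by (intro tendsto_eventually eventually_sequentiallyI[of k]) auto
    qed
    have conv: "(\<lambda>n. \<integral>x. f n x \<partial>\<rho>) \<longlonglongrightarrow> measure \<rho> C" if "\<rho> \<in> P2" for \<rho>
    proof -
      interpret r: prob_space \<rho> using that by (rule P2_prob_space)
      note [measurable_cong] = P2_sets[OF that]
      have "(\<lambda>n. \<integral>x. f n x \<partial>\<rho>) \<longlonglongrightarrow> (\<integral>x. indicat_real C x \<partial>\<rho>)"
        using lim b C_sets P2_sets[OF that]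
        by (intro integral_dominated_convergence[where w="\<lambda>_. 1"]) auto
      then show ?thesis
        using C_sets P2_sets[OF that] sets_eq_imp_space_eq[OF P2_sets[OF that]] by simp
    qed
    have "measure \<mu> C = measure \<nu> C"
      using conv[OF P2(1)] conv[OF P2(2)] unfolding eq by (rule LIMSEQ_unique)
    then show ?thesis by (simp add: m.emeasure_eq_measure n.emeasure_eq_measure)
  qed simp
  show ?thesis
  proof (rule measure_eqI_generator_eq[where E="Collect closed" and \<Omega>=UNIV and A="\<lambda>_. UNIV"])
    show "Int_stable (Collect closed :: 'a set set)" by (auto simp: Int_stable_def)
    show "sets \<mu> = sigma_sets UNIV (Collect closed)" "sets \<nu> = sigma_sets UNIV (Collect closed)"
      by (simp_all add: sets borel_eq_closed)
  qed (auto simp: closed_eq)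
qed

section \<open>The Wasserstein projection as a projection of maps\<close>

text \<open>Averaging \<open>Z\<close> over small cells of \<open>X\<close> gives a dominated map on
  \<open>\<mu>\<close>, and averaging \<open>X\<close> nearly gives the identity. Since averaging
  contracts, general couplings cannot beat maps.\<close>

lemma projection_le_coupling:
  fixes \<mu> \<nu> :: "'a::euclidean_space measure" and X Z :: "'b \<Rightarrow> 'a"
  assumes \<mu>: "\<mu> \<in> P2" and proj: "is_projection \<mu> (\<lambda>x. x) \<nu> T"
    and M: "prob_space M" and X: "square_integrable M X" and law: "distr M borel X = \<mu>"
    and Z: "dominated M Z \<nu>"
  shows "l2norm \<mu> (\<lambda>x. x - T x) \<le> l2norm M (\<lambda>y. X y - Z y)"
proof (rule field_le_epsilon)
  fix e :: real assume e: "0 < e"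
  note sets = P2_sets[OF \<mu>]
  have X_meas: "X \<in> measurable M \<mu>"
    using square_integrable_measurable[OF X] by (simp cong: measurable_cong_sets add: sets)
  have law': "distr M \<mu> X = \<mu>" using law sets by (metis distr_cong)
  note id = P2_square_integrable[OF \<mu>] and sqZ = dominated_square_integrable[OF Z]
  \<comment> \<open>Doubled by \<open>averaging_pullback_close\<close>, this error becomes the
    \<open>e\<close> of the claim.\<close>
  obtain R where R: "simple_function \<mu> R" "square_integrable \<mu> R" "l2norm \<mu> (\<lambda>x. x - R x) < e / 2"
    using square_integrable_simple_approx[OF id, of "e / 2"] e by auto
  define J where "J = {r \<in> R ` space \<mu>. 0 < measure \<mu> {x \<in> space \<mu>. R x = r}}"
  interpret averaging M \<mu> J R "\<lambda>r y. indicat_real {r} (R (X y))"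
    unfolding J_def by (rule averaging_pullback[OF M X_meas law' R(1)])
  have "l2norm \<mu> (\<lambda>x. x - T x) \<le> l2norm \<mu> (\<lambda>x. x - avg Z x)"
    using proj avg_dominated[OF Z] by (simp add: is_projection_def)
  also have "\<dots> \<le> l2norm \<mu> (\<lambda>x. x - avg X x) + l2norm \<mu> (\<lambda>x. avg X x - avg Z x)"
    by (intro l2norm_triangle id avg_square_integrable)
  also have "\<dots> \<le> e + l2norm M (\<lambda>y. X y - Z y)"
    using averaging_pullback_close[OF M X_meas law' R(1,2) id] R(3)
    by (intro add_mono avg_l2norm_diff_le X sqZ) auto
  finally show "l2norm \<mu> (\<lambda>x. x - T x) \<le> l2norm M (\<lambda>y. X y - Z y) + e" by simp
qed

text \<open>Resolving the definite description in \<open>I2\<close> requires both existence and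
  uniqueness of the minimizer. The second conclusion says that the identity paired with
  \<open>T\<close> is an optimal coupling.\<close>

lemma I2_eq_projection:
  fixes \<mu> \<nu> :: "'a::euclidean_space measure"
  assumes \<mu>: "\<mu> \<in> P2" and \<nu>: "\<nu> \<in> P2" and proj: "is_projection \<mu> (\<lambda>x. x) \<nu> T"
  shows "I2 \<mu> \<nu> = distr \<mu> borel T" "W2 \<mu> (I2 \<mu> \<nu>) = l2norm \<mu> (\<lambda>x. x - T x)"
proof -
  interpret m: prob_space \<mu> using \<mu> by (rule P2_prob_space)
  define d where "d = l2norm \<mu> (\<lambda>x. x - T x)"
  define \<eta>1 where "\<eta>1 = distr \<mu> borel T"
  have T: "dominated \<mu> T \<nu>" using proj by (simp add: is_projection_def)
  note sqT = dominated_square_integrable[OF T] and id = P2_square_integrable[OF \<mu>]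
  have \<eta>1: "\<eta>1 \<in> P2" "\<eta>1 \<le>\<^sub>c\<^sub>x \<nu>"
    unfolding \<eta>1_def using P2_distr[OF m.prob_space_axioms sqT]
      dominated_iff_convex_order[OF m.prob_space_axioms sqT \<nu>] T by auto
  have "distr \<mu> borel (\<lambda>x. x) = \<mu>" using P2_sets[OF \<mu>] by (simp add: distr_id2)
  then have le: "W2 \<mu> \<eta>1 \<le> d"
    using W2_distr_le[OF id[THEN square_integrable_measurable] sqT[THEN square_integrable_measurable]]
    by (simp add: d_def \<eta>1_def)
  have dom: "dominated \<pi> snd \<nu>" if "\<pi> \<in> couplings \<mu> \<eta>" "\<eta> \<in> P2" "\<eta> \<le>\<^sub>c\<^sub>x \<nu>" for \<pi> \<eta>
    using dominated_iff_convex_order[OF couplingsD(1,8)[OF that(1) \<mu> that(2)] \<nu>]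
      couplingsD(6)[OF that(1) \<mu> that(2)] that(3) by simp
  have ge: "d \<le> W2 \<mu> \<eta>" if \<eta>: "\<eta> \<in> P2" "\<eta> \<le>\<^sub>c\<^sub>x \<nu>" for \<eta>
  proof (rule field_le_epsilon)
    fix e :: real assume "0 < e"
    then obtain \<pi> where \<pi>: "\<pi> \<in> couplings \<mu> \<eta>" "l2norm \<pi> (\<lambda>z. fst z - snd z) < W2 \<mu> \<eta> + e"
      using W2_almost_attained[OF \<mu> \<eta>(1)] by metis
    note D = couplingsD[OF \<pi>(1) \<mu> \<eta>(1)]
    show "d \<le> W2 \<mu> \<eta> + e"
      using projection_le_coupling[OF \<mu> proj D(1,7,5) dom[OF \<pi>(1) \<eta>]] \<pi>(2) by (simp add: d_def)
  qed
  have W2_eq: "W2 \<mu> \<eta>1 = d" using le ge[OF \<eta>1] by simp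
  have unique: "\<eta> = \<eta>1" if \<eta>: "\<eta> \<in> P2" "\<eta> \<le>\<^sub>c\<^sub>x \<nu>" and min: "W2 \<mu> \<eta> \<le> d" for \<eta>
  proof (rule W2_eq_0_imp_eq[OF \<eta>(1) \<eta>1(1)])
    \<comment> \<open>Another minimizer is compared with the law of \<open>T\<close> on the space of
      a nearly optimal coupling with \<open>\<mu>\<close>; the bound vanishes with
      \<open>e\<close>.\<close>
    have "(W2 \<eta> \<eta>1)\<^sup>2 \<le> 2 * ((d + e)\<^sup>2 - d\<^sup>2)" if e: "0 < e" for e
    proof -
      obtain \<pi> where \<pi>: "\<pi> \<in> couplings \<mu> \<eta>" "l2norm \<pi> (\<lambda>z. fst z - snd z) < W2 \<mu> \<eta> + e"
        using W2_almost_attained[OF \<mu> \<eta>(1) e] .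
      note D = couplingsD[OF \<pi>(1) \<mu> \<eta>(1)]
      note [measurable] = D(3,4)
      interpret prob_space \<pi> by (rule D(1))
      have [measurable]: "T \<in> borel_measurable borel"
        using square_integrable_measurable[OF sqT] P2_sets[OF \<mu>] by (simp cong: measurable_cong_sets)
      have domT: "dominated \<pi> (\<lambda>z. T (fst z)) \<nu>"
        using T dominated_distr[OF D(3), of T \<nu>] by (simp add: D(5))
      note domZ = dom[OF \<pi>(1) \<eta>]
      have fstT: "l2norm \<pi> (\<lambda>z. fst z - T (fst z)) = d"
        using l2norm_distr[OF D(3), of "\<lambda>x. x - T x"] by (simp add: D(5) d_def)
      \<comment> \<open>The midpoint lives on the coupling space, where
        \<open>projection_le_coupling\<close> still gives the lower bound \<open>d\<close>; the
        parallelogram identity then bounds the distance of \<open>snd z\<close> and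
        \<open>T (fst z)\<close>.\<close>
      have mid: "dominated \<pi> (\<lambda>z. (1/2) *\<^sub>R snd z + (1/2) *\<^sub>R T (fst z)) \<nu>"
        by (rule dominated_convex[OF D(1) domZ domT]) auto
      have "d\<^sup>2 \<le> (l2norm \<pi> (\<lambda>z. fst z - ((1/2) *\<^sub>R snd z + (1/2) *\<^sub>R T (fst z))))\<^sup>2"
        using projection_le_coupling[OF \<mu> proj D(1,7,5) mid] by (intro power_mono) (auto simp: d_def)
      also have "\<dots> = (l2norm \<pi> (\<lambda>z. fst z - snd z))\<^sup>2 / 2 + d\<^sup>2 / 2
          - (l2norm \<pi> (\<lambda>z. snd z - T (fst z)))\<^sup>2 / 4"
        unfolding l2norm_midpoint[OF D(7,8) dominated_square_integrable[OF domT]] fstT ..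
      finally have "(l2norm \<pi> (\<lambda>z. snd z - T (fst z)))\<^sup>2 \<le> 2 * ((l2norm \<pi> (\<lambda>z. fst z - snd z))\<^sup>2 - d\<^sup>2)"
        by simp
      also have "\<dots> \<le> 2 * ((d + e)\<^sup>2 - d\<^sup>2)"
        using \<pi>(2) min by (intro mult_left_mono diff_right_mono power_mono) auto
      finally have "(l2norm \<pi> (\<lambda>z. snd z - T (fst z)))\<^sup>2 \<le> 2 * ((d + e)\<^sup>2 - d\<^sup>2)" .
      moreover have "W2 \<eta> \<eta>1 \<le> l2norm \<pi> (\<lambda>z. snd z - T (fst z))"
      proof -
        have "distr \<pi> borel (\<lambda>z. T (fst z)) = distr (distr \<pi> borel fst) borel T"
          by (simp add: distr_distr comp_def)
        then have "distr \<pi> borel (\<lambda>z. T (fst z)) = \<eta>1" by (simp add: D(5) \<eta>1_def)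
        then show ?thesis using W2_distr_le[of snd \<pi> "\<lambda>z. T (fst z)"] D(6) by simp
      qed
      then have "(W2 \<eta> \<eta>1)\<^sup>2 \<le> (l2norm \<pi> (\<lambda>z. snd z - T (fst z)))\<^sup>2"
        by (intro power_mono W2_nonneg \<eta> \<eta>1)
      ultimately show ?thesis by (rule order_trans[rotated])
    qed
    then have "eventually (\<lambda>e. (W2 \<eta> \<eta>1)\<^sup>2 \<le> 2 * ((d + e)\<^sup>2 - d\<^sup>2)) (at_right 0)"
      by (auto simp: eventually_at_filter)
    moreover have "((\<lambda>e. 2 * ((d + e)\<^sup>2 - d\<^sup>2)) \<longlongrightarrow> 2 * ((d + 0)\<^sup>2 - d\<^sup>2)) (at_right 0)"
      by (intro tendsto_intros)
    ultimately have "(W2 \<eta> \<eta>1)\<^sup>2 \<le> 2 * ((d + 0)\<^sup>2 - d\<^sup>2)" by (intro tendsto_lowerbound) auto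
    then show "W2 \<eta> \<eta>1 = 0" by simp
  qed
  have "I2 \<mu> \<nu> = \<eta>1"
    unfolding I2_def
  proof (rule the_equality)
    show "is_arg_min (W2 \<mu>) (\<lambda>\<eta>. \<eta> \<in> P2 \<and> \<eta> \<le>\<^sub>c\<^sub>x \<nu>) \<eta>1"
      using \<eta>1 ge by (auto simp: is_arg_min_def W2_eq not_less)
    fix \<eta> assume "is_arg_min (W2 \<mu>) (\<lambda>\<eta>. \<eta> \<in> P2 \<and> \<eta> \<le>\<^sub>c\<^sub>x \<nu>) \<eta>"
    then show "\<eta> = \<eta>1"
      using \<eta>1 by (intro unique) (auto simp: is_arg_min_def not_less W2_eq)
  qed
  then show "I2 \<mu> \<nu> = distr \<mu> borel T" "W2 \<mu> (I2 \<mu> \<nu>) = l2norm \<mu> (\<lambda>x. x - T x)"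
    using W2_eq by (simp_all add: \<eta>1_def d_def)
qed

section \<open>The stability estimate\<close>

definition centering :: "'b measure \<Rightarrow> ('b \<Rightarrow> 'a::euclidean_space) \<Rightarrow> 'b \<Rightarrow> 'a" where
  "centering M Z x = Z x - (\<integral>y. Z y \<partial>M)"

lemma (in prob_space) centering_square_integrable:
  "square_integrable M Z \<Longrightarrow> square_integrable M (centering M Z)"
  unfolding centering_def[abs_def] by (intro square_integrable_diff square_integrable_const)

lemma (in prob_space) centering_diff:
  assumes "square_integrable M Z" "square_integrable M W"
  shows "centering M (\<lambda>x. Z x - W x) x = centering M Z x - centering M W x"
  using assms[THEN square_integrable_integrable] by (simp add: centering_def)

text \<open>A constant subtracted from \<open>Z\<close> is orthogonal to \<open>W\<close>, which has
  mean zero.\<close>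

lemma (in prob_space) inner_centering:
  assumes Z: "square_integrable M Z" and W: "square_integrable M W" and mean0: "expectation W = 0"
  shows "expectation (\<lambda>x. centering M Z x \<bullet> centering M W x) = expectation (\<lambda>x. Z x \<bullet> W x)"
  using square_integrable_inner[OF Z W] square_integrable_integrable[OF W]
  by (simp add: centering_def mean0 inner_diff_left)

text \<open>Split \<open>T' - T\<close> into \<open>T' - S\<close> and \<open>S - T\<close> for a
  transported map \<open>S\<close> dominated by \<open>\<nu>\<close>. The second part contributes a
  nonpositive amount by the variational inequality, the first is bounded by Cauchy-Schwarz.\<close>

lemma projection_centered_estimate:
  fixes \<mu> \<nu> \<nu>' :: "'a::euclidean_space measure"
  assumes \<mu>: "\<mu> \<in> P2" and \<nu>: "\<nu> \<in> P2" and \<nu>': "\<nu>' \<in> P2"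
    and proj: "is_projection \<mu> (\<lambda>x. x) \<nu> T" and T': "dominated \<mu> T' \<nu>'"
  shows "(\<integral>x. centering \<mu> (\<lambda>x. x - T x) x \<bullet> centering \<mu> (\<lambda>x. T' x - T x) x \<partial>\<mu>)
    \<le> l2norm \<mu> (centering \<mu> (\<lambda>x. x - T x)) * centered_W2 \<nu>' \<nu>"
proof -
  interpret m: prob_space \<mu> using \<mu> by (rule P2_prob_space)
  have T: "dominated \<mu> T \<nu>" using proj by (simp add: is_projection_def)
  note id = P2_square_integrable[OF \<mu>]
    and sqT = dominated_square_integrable[OF T] and sqT' = dominated_square_integrable[OF T']
  define A where "A = (\<lambda>x. x - T x)"
  define I where "I = (\<integral>x. centering \<mu> A x \<bullet> centering \<mu> (\<lambda>x. T' x - T x) x \<partial>\<mu>)"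
  define k where "k = norm (mean \<nu>' - mean \<nu>)"
  define w where "w = W2 \<nu>' \<nu>"
  have sqA: "square_integrable \<mu> A" unfolding A_def by (intro square_integrable_diff id sqT)
  \<comment> \<open>One \<open>e\<close> is lost to the nearly optimal coupling, the other to the
    transport of \<open>T'\<close>.\<close>
  have "I \<le> l2norm \<mu> (centering \<mu> A) * sqrt ((w + 2 * e)\<^sup>2 - k\<^sup>2)" if e: "0 < e" for e
  proof -
    obtain \<pi> where \<pi>: "\<pi> \<in> couplings \<nu>' \<nu>" "l2norm \<pi> (\<lambda>z. fst z - snd z) < w + e"
      unfolding w_def using W2_almost_attained[OF \<nu>' \<nu> e] .
    obtain S where S: "dominated \<mu> S \<nu>"
      and ST': "l2norm \<mu> (\<lambda>x. S x - T' x) \<le> l2norm \<pi> (\<lambda>z. fst z - snd z) + e"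
      using dominated_transport[OF m.prob_space_axioms T' \<nu> \<nu>' \<pi>(1) e] .
    note sqS = dominated_square_integrable[OF S]
    have sq: "square_integrable \<mu> (\<lambda>x. T' x - S x)" "square_integrable \<mu> (\<lambda>x. T' x - T x)"
        "square_integrable \<mu> (\<lambda>x. S x - T x)"
      by (intro square_integrable_diff sqT sqT' sqS)+
    have "(\<integral>x. S x - T x \<partial>\<mu>) = 0"
      using sqS sqT dominated_mean[OF m.prob_space_axioms S \<nu>] dominated_mean[OF m.prob_space_axioms T \<nu>]
      by (simp add: m.square_integrable_integrable)
    then have "(\<integral>x. centering \<mu> A x \<bullet> centering \<mu> (\<lambda>x. S x - T x) x \<partial>\<mu>) = (\<integral>x. A x \<bullet> (S x - T x) \<partial>\<mu>)"
      by (rule m.inner_centering[OF sqA sq(3)])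
    also have "\<dots> \<le> 0" unfolding A_def by (rule m.projection_variational[OF id proj S])
    finally have VI: "(\<integral>x. centering \<mu> A x \<bullet> centering \<mu> (\<lambda>x. S x - T x) x \<partial>\<mu>) \<le> 0" .
    have "centering \<mu> (\<lambda>x. S x - T x) x
        = centering \<mu> (\<lambda>x. T' x - T x) x - centering \<mu> (\<lambda>x. T' x - S x) x" for x
      using m.centering_diff[OF sq(2,1), of x] by simp
    then have "(\<integral>x. centering \<mu> A x \<bullet> centering \<mu> (\<lambda>x. S x - T x) x \<partial>\<mu>)
        = I - (\<integral>x. centering \<mu> A x \<bullet> centering \<mu> (\<lambda>x. T' x - S x) x \<partial>\<mu>)"
      using square_integrable_inner[OF m.centering_square_integrable[OF sqA] m.centering_square_integrable[OF sq(1)]]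
        square_integrable_inner[OF m.centering_square_integrable[OF sqA] m.centering_square_integrable[OF sq(2)]]
      by (simp add: I_def inner_diff_right)
    with VI have "I \<le> (\<integral>x. centering \<mu> A x \<bullet> centering \<mu> (\<lambda>x. T' x - S x) x \<partial>\<mu>)" by simp
    also have "\<dots> \<le> l2norm \<mu> (centering \<mu> A) * l2norm \<mu> (centering \<mu> (\<lambda>x. T' x - S x))"
      by (intro l2norm_Cauchy_Schwarz m.centering_square_integrable sqA sq)
    also have "\<dots> \<le> l2norm \<mu> (centering \<mu> A) * sqrt ((w + 2 * e)\<^sup>2 - k\<^sup>2)"
    proof (intro mult_left_mono real_le_rsqrt)
      have "(\<integral>x. T' x - S x \<partial>\<mu>) = mean \<nu>' - mean \<nu>"
        using sqS sqT' dominated_mean[OF m.prob_space_axioms S \<nu>] dominated_mean[OF m.prob_space_axioms T' \<nu>']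
        by (simp add: m.square_integrable_integrable)
      then have "(l2norm \<mu> (centering \<mu> (\<lambda>x. T' x - S x)))\<^sup>2 = (l2norm \<mu> (\<lambda>x. T' x - S x))\<^sup>2 - k\<^sup>2"
        using m.l2norm_centered[OF sq(1)] by (simp add: centering_def[abs_def] k_def)
      also have "l2norm \<mu> (\<lambda>x. T' x - S x) \<le> w + 2 * e"
        using ST' \<pi>(2) by (simp add: l2norm_minus_commute[of \<mu> T'])
      then have "(l2norm \<mu> (\<lambda>x. T' x - S x))\<^sup>2 - k\<^sup>2 \<le> (w + 2 * e)\<^sup>2 - k\<^sup>2"
        by (intro diff_right_mono power_mono) auto
      finally show "(l2norm \<mu> (centering \<mu> (\<lambda>x. T' x - S x)))\<^sup>2 \<le> (w + 2 * e)\<^sup>2 - k\<^sup>2" .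
    qed simp
    finally show ?thesis .
  qed
  then have "eventually (\<lambda>e. I \<le> l2norm \<mu> (centering \<mu> A) * sqrt ((w + 2 * e)\<^sup>2 - k\<^sup>2)) (at_right 0)"
    by (auto simp: eventually_at_filter)
  moreover have "((\<lambda>e. l2norm \<mu> (centering \<mu> A) * sqrt ((w + 2 * e)\<^sup>2 - k\<^sup>2))
      \<longlongrightarrow> l2norm \<mu> (centering \<mu> A) * sqrt ((w + 2 * 0)\<^sup>2 - k\<^sup>2)) (at_right 0)"
    by (intro tendsto_intros)
  ultimately have "I \<le> l2norm \<mu> (centering \<mu> A) * sqrt ((w + 2 * 0)\<^sup>2 - k\<^sup>2)"
    by (intro tendsto_lowerbound) auto
  then show ?thesis by (simp add: I_def A_def w_def k_def centered_W2_def)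
qed

text \<open>The estimate for a projection is used twice, with the roles of \<open>\<nu>\<close> and
  \<open>\<nu>'\<close> exchanged, and the two bounds are added.\<close>

lemma centered_W2_I2_le:
  fixes \<mu> \<nu> \<nu>' :: "'a::euclidean_space measure"
  assumes \<mu>: "\<mu> \<in> P2" and \<nu>: "\<nu> \<in> P2" and \<nu>': "\<nu>' \<in> P2"
  shows "(centered_W2 (I2 \<mu> \<nu>) (I2 \<mu> \<nu>'))\<^sup>2
    \<le> (centered_W2 \<mu> (I2 \<mu> \<nu>) + centered_W2 \<mu> (I2 \<mu> \<nu>')) * centered_W2 \<nu> \<nu>'"
proof -
  interpret m: prob_space \<mu> using \<mu> by (rule P2_prob_space)
  note id = P2_square_integrable[OF \<mu>]
  obtain T where T: "is_projection \<mu> (\<lambda>x. x) \<nu> T" using m.projection_exists[OF id \<nu>] .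
  obtain T' where T': "is_projection \<mu> (\<lambda>x. x) \<nu>' T'" using m.projection_exists[OF id \<nu>'] .
  have dom: "dominated \<mu> T \<nu>" "dominated \<mu> T' \<nu>'" using T T' by (auto simp: is_projection_def)
  note sqT = dominated_square_integrable[OF dom(1)] and sqT' = dominated_square_integrable[OF dom(2)]
  have mean_distr: "mean (distr \<mu> borel V) = mean \<rho>"
    if "dominated \<mu> V \<rho>" "\<rho> \<in> P2" for V :: "'a \<Rightarrow> 'a" and \<rho>
    using dominated_mean[OF m.prob_space_axioms that]
      square_integrable_measurable[OF dominated_square_integrable[OF that(1)]]
    by (simp add: mean_def integral_distr)
  \<comment> \<open>An equality, since the identity paired with \<open>V\<close> is an optimal
    coupling of \<open>\<mu>\<close> and \<open>I2 \<mu> \<rho>\<close>.\<close>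
  have residual: "l2norm \<mu> (centering \<mu> (\<lambda>x. x - V x)) = centered_W2 \<mu> (I2 \<mu> \<rho>)"
    if V: "is_projection \<mu> (\<lambda>x. x) \<rho> V" and \<rho>: "\<rho> \<in> P2" for V \<rho>
  proof -
    have domV: "dominated \<mu> V \<rho>" using V by (simp add: is_projection_def)
    note sqV = dominated_square_integrable[OF domV] and I2 = I2_eq_projection[OF \<mu> \<rho> V]
    have "(\<integral>x. x - V x \<partial>\<mu>) = mean \<mu> - mean \<rho>"
      using dominated_mean[OF m.prob_space_axioms domV \<rho>] id sqV
      by (simp add: m.square_integrable_integrable mean_def)
    then have "(l2norm \<mu> (centering \<mu> (\<lambda>x. x - V x)))\<^sup>2 = (W2 \<mu> (I2 \<mu> \<rho>))\<^sup>2 - (norm (mean \<mu> - mean \<rho>))\<^sup>2"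
      using m.l2norm_centered[OF square_integrable_diff[OF id sqV]] I2(2)
      by (simp add: centering_def[abs_def])
    also have "\<dots> = (centered_W2 \<mu> (I2 \<mu> \<rho>))\<^sup>2"
      using centered_W2_power2[OF \<mu> P2_distr[OF m.prob_space_axioms sqV]] mean_distr[OF domV \<rho>] I2(1)
      by simp
    \<comment> \<open>Taking roots needs \<open>centered_W2\<close> to be nonnegative, which rests
      on \<open>norm_mean_diff_le_W2\<close>.\<close>
    finally show ?thesis
      by (rule power2_eq_imp_eq)
        (auto simp: centered_W2_def I2(1) mean_distr[OF domV \<rho>]
          intro!: power_mono norm_mean_diff_le_W2[OF \<mu> P2_distr[OF m.prob_space_axioms sqV], unfolded mean_distr[OF domV \<rho>]])
  qed
  define A where "A = centering \<mu> (\<lambda>x. x - T x)"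
  define A' where "A' = centering \<mu> (\<lambda>x. x - T' x)"
  define D where "D = centering \<mu> (\<lambda>x. T' x - T x)"
  have sq: "square_integrable \<mu> A" "square_integrable \<mu> A'" "square_integrable \<mu> D"
    unfolding A_def A'_def D_def by (intro m.centering_square_integrable square_integrable_diff id sqT sqT')+
  have eq: "A x - A' x = D x" for x
    unfolding A_def A'_def D_def
    by (subst m.centering_diff[symmetric]) (auto intro!: square_integrable_diff id sqT sqT')
  have D': "centering \<mu> (\<lambda>x. T x - T' x) x = - D x" for x
    unfolding D_def by (simp add: m.centering_diff sqT sqT')
  \<comment> \<open>Only an inequality: \<open>T\<close> and \<open>T'\<close> form some coupling of
    the two projections, not necessarily an optimal one.\<close>
  have "(centered_W2 (I2 \<mu> \<nu>) (I2 \<mu> \<nu>'))\<^sup>2 \<le> (l2norm \<mu> D)\<^sup>2"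
  proof -
    have "(\<integral>x. T' x - T x \<partial>\<mu>) = mean \<nu>' - mean \<nu>"
      using dominated_mean[OF m.prob_space_axioms dom(1) \<nu>] dominated_mean[OF m.prob_space_axioms dom(2) \<nu>']
      by (simp add: m.square_integrable_integrable sqT sqT')
    then have "(l2norm \<mu> D)\<^sup>2 = (l2norm \<mu> (\<lambda>x. T x - T' x))\<^sup>2 - (norm (mean \<nu> - mean \<nu>'))\<^sup>2"
      using m.l2norm_centered[OF square_integrable_diff[OF sqT' sqT]]
      by (simp add: D_def centering_def[abs_def] norm_minus_commute l2norm_minus_commute[of \<mu> T'])
    moreover have "(W2 (I2 \<mu> \<nu>) (I2 \<mu> \<nu>'))\<^sup>2 \<le> (l2norm \<mu> (\<lambda>x. T x - T' x))\<^sup>2"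
      unfolding I2_eq_projection(1)[OF \<mu> \<nu> T] I2_eq_projection(1)[OF \<mu> \<nu>' T']
      by (intro power_mono W2_distr_le W2_nonneg P2_distr square_integrable_measurable sqT sqT' m.prob_space_axioms)
    ultimately show ?thesis
      using centered_W2_power2[OF P2_distr[OF m.prob_space_axioms sqT] P2_distr[OF m.prob_space_axioms sqT']]
      by (simp add: I2_eq_projection(1)[OF \<mu> \<nu> T] I2_eq_projection(1)[OF \<mu> \<nu>' T']
          mean_distr[OF dom(1) \<nu>] mean_distr[OF dom(2) \<nu>'])
  qed
  \<comment> \<open>One factor \<open>D\<close> is written as \<open>A - A'\<close>; the sign of the
    second term turns \<open>D\<close> into the centered \<open>T - T'\<close>.\<close>
  also have "(l2norm \<mu> D)\<^sup>2 = (\<integral>x. A x \<bullet> D x - A' x \<bullet> D x \<partial>\<mu>)"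
    unfolding l2norm_power2 eq[symmetric] by (simp add: power2_norm_eq_inner inner_diff_left)
  also have "\<dots> = (\<integral>x. A x \<bullet> D x \<partial>\<mu>) + (\<integral>x. A' x \<bullet> centering \<mu> (\<lambda>x. T x - T' x) x \<partial>\<mu>)"
    using square_integrable_inner[OF sq(1,3)] square_integrable_inner[OF sq(2,3)] by (simp add: D')
  also have "\<dots> \<le> l2norm \<mu> A * centered_W2 \<nu>' \<nu> + l2norm \<mu> A' * centered_W2 \<nu> \<nu>'"
    unfolding A_def A'_def D_def
    by (intro add_mono projection_centered_estimate \<mu> \<nu> \<nu>' T T' dom)
  also have "\<dots> = (centered_W2 \<mu> (I2 \<mu> \<nu>) + centered_W2 \<mu> (I2 \<mu> \<nu>')) * centered_W2 \<nu> \<nu>'"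
    unfolding A_def A'_def residual[OF T \<nu>] residual[OF T' \<nu>'] centered_W2_commute[OF \<nu>' \<nu>]
    by (simp add: distrib_right)
  finally show ?thesis .
qed

text \<open>The index type is finite and nonempty, so the type \<open>real ^ 'n\<close> ranges over
  the spaces of dimension at least 1.\<close>

theorem proposition2p9:
  fixes \<mu> \<nu> \<nu>' :: "(real ^ 'n::finite) measure"
  assumes "\<mu> \<in> P2" and "\<nu> \<in> P2" and "\<nu>' \<in> P2"
  shows "(centered_W2 (I2 \<mu> \<nu>) (I2 \<mu> \<nu>'))\<^sup>2
         \<le> (centered_W2 \<mu> (I2 \<mu> \<nu>) + centered_W2 \<mu> (I2 \<mu> \<nu>')) * centered_W2 \<nu> \<nu>'"
  using assms by (rule centered_W2_I2_le)

end
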